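(* Let $\hbar,m,L>0$, let $k\in\mathbb{R}\setminus\{0\}$, and let the potentials $Q_I$, $Q$ (with exterior constants $Q_{I,L}$, $Q_L$), the space grid, the time grid, and the discrete potentials be as in the context. Let $\Phi=(\Phi_j)_{0\le j\le J}$ be the solution to the stationary finite difference scheme $$\frac{\Phi_{j+1}-2\Phi_j+\Phi_{j-1}}{\Delta x^2}=\frac{2m}{\hbar^2}(Q_{I,j}-E_k)\Phi_j,\qquad j=1,\dots,J-1,$$ with the stationary discrete transparent boundary conditions (S+) if $k>0$ and (S-) if $k<0$ given in the context. Let $\Psi=(\Psi^l_j)$ be the solution to the Crank-Nicolson scheme $$i\hbar\,\frac{\Psi_j^{l+1}-\Psi_j^l}{\Delta t}=-\frac{\hbar^2}{2m}\,\frac{\Psi^{l+1/2}_{j+1}-2\Psi^{l+1/2}_j+\Psi^{l+1/2}_{j-1}}{\Delta x^2}+Q_j^{l+1/2}\Psi_j^{l+1/2},\qquad j=1,\dots,J-1,\quad l\ge 0,$$ where $\Psi_j^{l+1/2}=\frac12(\Psi_j^l+\Psi_j^{l+1})$, with the initial condition $\Psi^0=\Phi$ and the non-homogeneous discrete transparent boundary conditions (T0) and (TL) given in the context, in which the angular frequencies are $$\omega_0=\frac{2}{\Delta t}\arctan\Big(\frac{\Delta t\,E_k}{2\hbar}\Big),\qquad \omega_L=\frac{2}{\Delta t}\arctan\Big(\frac{\Delta t}{2\hbar}(E_k+Q_L-Q_{I,L})\Big).$$ Then there exists a constant $C>0$ which depends only on $\hbar$, $m$, $L$, $Q_{I,L}$,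 $\sup_{x\in(0,L)}|Q_I(x)|$, $Q_L$, $k$ such that, for all $\Delta x$ verifying $$\Delta x<\frac{1}{\sqrt{k^2+\frac{2m}{\hbar^2}|Q_{I,L}|}},$$ it holds for all $N\ge 0$: $$\Vert\Psi^l\Vert_2\le C\Big[\Big(1+\max_{0\le n\le N}\Vert Q^{n+1/2}\Vert_\infty\Big)T+1\Big],\qquad 0\le l\le N,$$ where $T=N\Delta t$, $\Vert Q^{n+1/2}\Vert_\infty=\max_{1\le j\le J-1}|Q^{n+1/2}_j|$ and $\Vert\Psi^l\Vert_2^2=\sum_{j=1}^{J-1}|\Psi^l_j|^2\Delta x$.
   Context: Potentials. $Q_I:\mathbb{R}\to\mathbb{R}$ is a (bounded) real potential with $Q_I(x)=0$ for $x\le 0$ and $Q_I(x)=Q_{I,L}$ for $x\ge L$, where $Q_{I,L}\in\mathbb{R}$ is a constant. $Q(t,x)$ is a real time-dependent potential with, for $t>0$, $Q(t,x)=0$ for $x\le0$ and $Q(t,x)=Q_L$ for $x\ge L$, where $Q_L\in\mathbb{R}$ is a constant, and with $Q(0,x)=Q_I(x)$. Grids. The interval $[0,L]$ is discretized by the uniform grid $x_j=j\Delta x$, $0\le j\le J$, $\Delta x=L/J$, $J\ge1$ an integer; the time grid is $t^l=l\Delta t$, $l\ge0$, with time step $\Delta t>0$. $Q_{I,j}=Q_I(x_j)$, and the real number $Q_j^{l+1/2}$ denotes the approximation of $Q((l+\frac12)\Delta t,x_j)$ used in the scheme. Energy. $E_k=\frac{\hbar^2k^2}{2m}$ if $k>0$,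 and $E_k=\frac{\hbar^2k^2}{2m}+Q_{I,L}$ if $k<0$. Stationary boundary conditions. Set $$\alpha_{1,2}=1-\Delta x^2\tfrac{k^2}{2}\pm i\sqrt{\Delta x^2k^2-\Delta x^4\tfrac{k^4}{4}}$$ ($\alpha_1$ with the sign $+$, $\alpha_2$ with the sign $-$). Square roots are principal values (so $\sqrt{-a}=i\sqrt{a}$ for $a>0$). (S+) For $k>0$, set $$\beta_{1,2}=1-\Delta x^2\Big(\tfrac{k^2}{2}-\tfrac{m}{\hbar^2}Q_{I,L}\Big)\pm i\sqrt{\Delta x^2\Big(k^2-\tfrac{2m}{\hbar^2}Q_{I,L}\Big)-\Delta x^4\Big(\tfrac{k^2}{2}-\tfrac{m}{\hbar^2}Q_{I,L}\Big)^2}.$$ The boundary conditions are $\alpha_1^{-1}\Phi_0-\Phi_1=\alpha_1^{-1}-\alpha_1$ and $-\Phi_{J-1}+\beta_1^{-1}\Phi_J=0$. (S-) For $k<0$, set $$\beta_{1,2}=1-\Delta x^2\Big(\tfrac{k^2}{2}+\tfrac{m}{\hbar^2}Q_{I,L}\Big)\pm i\sqrt{\Delta x^2\Big(k^2+\tfrac{2m}{\hbar^2}Q_{I,L}\Big)-\Delta x^4\Big(\tfrac{k^2}{2}+\tfrac{m}{\hbar^2}Q_{I,L}\Big)^2}.$$ The boundary conditions are $\beta_2\Phi_0-\Phi_1=0$ and $-\Phi_{J-1}+\alpha_2\Phi_J=\alpha_2^J(\alpha_2-\alpha_2^{-1})$. Convolution coefficients. For $j\in\{0,J\}$ and $l\ge0$,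 $$s_j^l=\Big[1-i\tfrac{R}{2}+\tfrac{\sigma_j}{2}\Big]\delta_l^0+\Big[1+i\tfrac{R}{2}+\tfrac{\sigma_j}{2}\Big]\delta_l^1+a_j\,e^{-il\varphi_j}\,\frac{P_l(\mu_j)-P_{l-2}(\mu_j)}{2l-1},$$ where $\delta$ is the Kronecker symbol, $P_l$ are the Legendre polynomials with the convention $P_{-1}=P_{-2}=0$, and $$R=\frac{4m\Delta x^2}{\hbar\Delta t},\qquad \sigma_0=0,\qquad \sigma_J=\frac{2m\Delta x^2}{\hbar^2}Q_L,$$ $$\varphi_j=\arctan\frac{2R(\sigma_j+2)}{R^2-4\sigma_j-\sigma_j^2},\qquad \mu_j=\frac{R^2+4\sigma_j+\sigma_j^2}{\sqrt{(R^2+\sigma_j^2)[R^2+(\sigma_j+4)^2]}},$$ $$a_j=\frac{i}{2}\big((R^2+\sigma_j^2)[R^2+(\sigma_j+4)^2]\big)^{1/4}e^{i\varphi_j/2}.$$ Here the arctangent is understood with the quadrant taken into account, i.e. $\varphi_j\in(-\pi,\pi)$ is the principal argument of the complex number $(R^2-4\sigma_j-\sigma_j^2)+2iR(\sigma_j+2)$. Time-dependent boundary conditions. For all $l\ge1$ (empty sums are zero): (T0) $$\Psi^l_1-s_0^0\Psi^l_0=\sum_{p=1}^{l-1}s_0^{l-p}\big(\Psi_0^p-\Phi_0e^{-i\omega_0t^p}\big)-\big(\Psi_1^{l-1}-\Phi_1e^{-i\omega_0t^{l-1}}\big)+\Phi_1e^{-i\omega_0t^l}-s_0^0\Phi_0e^{-i\omega_0t^l};$$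 (TL) $$\Psi^l_{J-1}-s_J^0\Psi^l_J=\sum_{p=1}^{l-1}s_J^{l-p}\big(\Psi_J^p-\Phi_Je^{-i\omega_Lt^p}\big)-\big(\Psi_{J-1}^{l-1}-\Phi_{J-1}e^{-i\omega_Lt^{l-1}}\big)+\Phi_{J-1}e^{-i\omega_Lt^l}-s_J^0\Phi_Je^{-i\omega_Lt^l}.$$ *)

theory Defs
  imports "HOL-Analysis.Analysis"
begin

definition initial_potential :: "real \<Rightarrow> real \<Rightarrow> (real \<Rightarrow> real) \<Rightarrow> bool" where
  "initial_potential L QIL QI \<longleftrightarrow>
     bounded (range QI) \<and> (\<forall>x\<le>0. QI x = 0) \<and> (\<forall>x\<ge>L. QI x = QIL)"

text \<open>The values at times \<open>t < 0\<close> are irrelevant and left unconstrained.\<close>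
definition time_potential ::
    "real \<Rightarrow> real \<Rightarrow> (real \<Rightarrow> real) \<Rightarrow> (real \<Rightarrow> real \<Rightarrow> real) \<Rightarrow> bool" where
  "time_potential L QL QI Q \<longleftrightarrow>
     (\<forall>t>0. (\<forall>x\<le>0. Q t x = 0) \<and> (\<forall>x\<ge>L. Q t x = QL)) \<and> (\<forall>x. Q 0 x = QI x)"

definition energy :: "real \<Rightarrow> real \<Rightarrow> real \<Rightarrow> real \<Rightarrow> real" where
  "energy hbar m QIL k =
     (if k > 0 then hbar\<^sup>2 * k\<^sup>2 / (2 * m) else hbar\<^sup>2 * k\<^sup>2 / (2 * m) + QIL)"

subsection \<open>Stationary scheme\<close>

text \<open>
  \<open>csqrt\<close> is the principal square root, so that \<open>csqrt (- a) = \<i> * sqrt a\<close> for \<open>a > 0\<close>.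
  In each case \<open>alpha\<close> and \<open>beta\<close> are the characteristic roots of the scheme in the two
  exterior domains; \<open>beta1_right\<close> belongs to \<open>k > 0\<close> (domain to the right of \<open>L\<close>) and
  \<open>beta2_left\<close> to \<open>k < 0\<close> (domain to the left of \<open>0\<close>).
\<close>

definition alpha1 :: "real \<Rightarrow> real \<Rightarrow> complex" where
  "alpha1 k dx = of_real (1 - dx\<^sup>2 * (k\<^sup>2 / 2))
     + \<i> * csqrt (of_real (dx\<^sup>2 * k\<^sup>2 - dx ^ 4 * (k ^ 4 / 4)))"

definition alpha2 :: "real \<Rightarrow> real \<Rightarrow> complex" where
  "alpha2 k dx = of_real (1 - dx\<^sup>2 * (k\<^sup>2 / 2))
     - \<i> * csqrt (of_real (dx\<^sup>2 * k\<^sup>2 - dx ^ 4 * (k ^ 4 / 4)))"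

definition beta1_right :: "real \<Rightarrow> real \<Rightarrow> real \<Rightarrow> real \<Rightarrow> real \<Rightarrow> complex" where
  "beta1_right hbar m QIL k dx =
     of_real (1 - dx\<^sup>2 * (k\<^sup>2 / 2 - m / hbar\<^sup>2 * QIL))
     + \<i> * csqrt (of_real (dx\<^sup>2 * (k\<^sup>2 - 2 * m / hbar\<^sup>2 * QIL)
                         - dx ^ 4 * (k\<^sup>2 / 2 - m / hbar\<^sup>2 * QIL)\<^sup>2))"

definition beta2_left :: "real \<Rightarrow> real \<Rightarrow> real \<Rightarrow> real \<Rightarrow> real \<Rightarrow> complex" where
  "beta2_left hbar m QIL k dx =
     of_real (1 - dx\<^sup>2 * (k\<^sup>2 / 2 + m / hbar\<^sup>2 * QIL))
     - \<i> * csqrt (of_real (dx\<^sup>2 * (k\<^sup>2 + 2 * m / hbar\<^sup>2 * QIL)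
                         - dx ^ 4 * (k\<^sup>2 / 2 + m / hbar\<^sup>2 * QIL)\<^sup>2))"

definition stationary_bc ::
    "real \<Rightarrow> real \<Rightarrow> real \<Rightarrow> real \<Rightarrow> nat \<Rightarrow> real \<Rightarrow> (nat \<Rightarrow> complex) \<Rightarrow> bool" where
  "stationary_bc hbar m QIL k J dx \<Phi> \<longleftrightarrow>
     (if k > 0 then
        inverse (alpha1 k dx) * \<Phi> 0 - \<Phi> 1 = inverse (alpha1 k dx) - alpha1 k dx \<and>
        - \<Phi> (J - 1) + inverse (beta1_right hbar m QIL k dx) * \<Phi> J = 0
      else
        beta2_left hbar m QIL k dx * \<Phi> 0 - \<Phi> 1 = 0 \<and>
        - \<Phi> (J - 1) + alpha2 k dx * \<Phi> J
          = alpha2 k dx ^ J * (alpha2 k dx - inverse (alpha2 k dx)))"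

text \<open>
  Grid functions on \<open>0, \<dots>, J\<close> are functions on \<open>nat\<close>; values at indices above \<open>J\<close> are
  unconstrained and are never used.
\<close>
definition stationary_solution ::
    "real \<Rightarrow> real \<Rightarrow> real \<Rightarrow> real \<Rightarrow> (real \<Rightarrow> real) \<Rightarrow> nat \<Rightarrow> real \<Rightarrow> (nat \<Rightarrow> complex) \<Rightarrow> bool" where
  "stationary_solution hbar m QIL k QI J dx \<Phi> \<longleftrightarrow>
     (\<forall>j\<in>{1..<J}. (\<Phi> (j + 1) - 2 * \<Phi> j + \<Phi> (j - 1)) / of_real (dx\<^sup>2)
        = of_real (2 * m / hbar\<^sup>2 * (QI (real j * dx) - energy hbar m QIL k)) * \<Phi> j) \<and>
     stationary_bc hbar m QIL k J dx \<Phi>"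

subsection \<open>Convolution coefficients\<close>

text \<open>Legendre polynomials, by Bonnet's recursion.\<close>
fun legendre :: "nat \<Rightarrow> real \<Rightarrow> real" where
  "legendre 0 x = 1"
| "legendre (Suc 0) x = x"
| "legendre (Suc (Suc n)) x =
     ((2 * real n + 3) * x * legendre (Suc n) x - (real n + 1) * legendre n x) / (real n + 2)"

definition legendre_int :: "int \<Rightarrow> real \<Rightarrow> real" where
  "legendre_int n x = (if n < 0 then 0 else legendre (nat n) x)"

definition conv_R :: "real \<Rightarrow> real \<Rightarrow> real \<Rightarrow> real \<Rightarrow> real" where
  "conv_R hbar m dx dt = 4 * m * dx\<^sup>2 / (hbar * dt)"

definition conv_sigma :: "real \<Rightarrow> real \<Rightarrow> real \<Rightarrow> real \<Rightarrow> real" where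
  "conv_sigma hbar m dx V = 2 * m * dx\<^sup>2 / hbar\<^sup>2 * V"

definition conv_phi :: "real \<Rightarrow> real \<Rightarrow> real" where
  "conv_phi R \<sigma> = Arg (Complex (R\<^sup>2 - 4 * \<sigma> - \<sigma>\<^sup>2) (2 * R * (\<sigma> + 2)))"

definition conv_mu :: "real \<Rightarrow> real \<Rightarrow> real" where
  "conv_mu R \<sigma> = (R\<^sup>2 + 4 * \<sigma> + \<sigma>\<^sup>2) / sqrt ((R\<^sup>2 + \<sigma>\<^sup>2) * (R\<^sup>2 + (\<sigma> + 4)\<^sup>2))"

definition conv_a :: "real \<Rightarrow> real \<Rightarrow> complex" where
  "conv_a R \<sigma> = \<i> / 2 * of_real (root 4 ((R\<^sup>2 + \<sigma>\<^sup>2) * (R\<^sup>2 + (\<sigma> + 4)\<^sup>2)))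
     * exp (\<i> * of_real (conv_phi R \<sigma> / 2))"

definition conv_s :: "real \<Rightarrow> real \<Rightarrow> nat \<Rightarrow> complex" where
  "conv_s R \<sigma> l =
     (1 - \<i> * of_real (R / 2) + of_real (\<sigma> / 2)) * (if l = 0 then 1 else 0)
   + (1 + \<i> * of_real (R / 2) + of_real (\<sigma> / 2)) * (if l = 1 then 1 else 0)
   + conv_a R \<sigma> * exp (- \<i> * of_real (real l * conv_phi R \<sigma>))
       * of_real ((legendre_int (int l) (conv_mu R \<sigma>) - legendre_int (int l - 2) (conv_mu R \<sigma>))
                  / (2 * real l - 1))"

subsection \<open>Time-dependent scheme\<close>

text \<open>
  Both non-homogeneous transparent boundary conditions have the same form: \<open>b\<close> is the boundary
  node (\<open>0\<close> or \<open>J\<close>), \<open>i\<close> the adjacent node (\<open>1\<close> or \<open>J - 1\<close>), \<open>s\<close> the sequence of convolution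
  coefficients and \<open>\<omega>\<close> the angular frequency attached to that end.
\<close>
definition transparent_bc ::
    "(nat \<Rightarrow> complex) \<Rightarrow> real \<Rightarrow> real \<Rightarrow> nat \<Rightarrow> nat \<Rightarrow> (nat \<Rightarrow> complex)
       \<Rightarrow> (nat \<Rightarrow> nat \<Rightarrow> complex) \<Rightarrow> bool" where
  "transparent_bc s \<omega> dt b i \<Phi> \<Psi> \<longleftrightarrow>
     (let e = (\<lambda>l::nat. exp (- \<i> * of_real (\<omega> * (real l * dt)))) in
      \<forall>l\<ge>1. \<Psi> l i - s 0 * \<Psi> l b =
        (\<Sum>p\<in>{1..<l}. s (l - p) * (\<Psi> p b - \<Phi> b * e p))
        - (\<Psi> (l - 1) i - \<Phi> i * e (l - 1))
        + \<Phi> i * e l - s 0 * \<Phi> b * e l)"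

definition omega_0 :: "real \<Rightarrow> real \<Rightarrow> real \<Rightarrow> real \<Rightarrow> real \<Rightarrow> real" where
  "omega_0 hbar m QIL k dt = 2 / dt * arctan (dt * energy hbar m QIL k / (2 * hbar))"

definition omega_L :: "real \<Rightarrow> real \<Rightarrow> real \<Rightarrow> real \<Rightarrow> real \<Rightarrow> real \<Rightarrow> real" where
  "omega_L hbar m QIL QL k dt =
     2 / dt * arctan (dt / (2 * hbar) * (energy hbar m QIL k + QL - QIL))"

text \<open>
  \<open>\<Psi> l j\<close> stands for \<open>\<Psi>\<^sub>j\<close> at time \<open>l * dt\<close>, and \<open>Qh l j\<close> for the potential value used by the
  scheme at time \<open>(l + 1/2) * dt\<close> and node \<open>j\<close>.
\<close>
definition crank_nicolson ::
    "real \<Rightarrow> real \<Rightarrow> (nat \<Rightarrow> nat \<Rightarrow> real) \<Rightarrow> nat \<Rightarrow> real \<Rightarrow> real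
       \<Rightarrow> (nat \<Rightarrow> nat \<Rightarrow> complex) \<Rightarrow> bool" where
  "crank_nicolson hbar m Qh J dx dt \<Psi> \<longleftrightarrow>
     (let \<Psi>h = (\<lambda>l j. (\<Psi> l j + \<Psi> (l + 1) j) / 2) in
      \<forall>l. \<forall>j\<in>{1..<J}.
        \<i> * of_real hbar * ((\<Psi> (l + 1) j - \<Psi> l j) / of_real dt) =
          - of_real (hbar\<^sup>2 / (2 * m))
              * ((\<Psi>h l (j + 1) - 2 * \<Psi>h l j + \<Psi>h l (j - 1)) / of_real (dx\<^sup>2))
          + of_real (Qh l j) * \<Psi>h l j)"

definition time_dependent_solution ::
    "real \<Rightarrow> real \<Rightarrow> real \<Rightarrow> real \<Rightarrow> real \<Rightarrow> (nat \<Rightarrow> nat \<Rightarrow> real) \<Rightarrow> nat \<Rightarrow> real \<Rightarrow> real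
       \<Rightarrow> (nat \<Rightarrow> complex) \<Rightarrow> (nat \<Rightarrow> nat \<Rightarrow> complex) \<Rightarrow> bool" where
  "time_dependent_solution hbar m QIL QL k Qh J dx dt \<Phi> \<Psi> \<longleftrightarrow>
     crank_nicolson hbar m Qh J dx dt \<Psi> \<and>
     (\<forall>j\<le>J. \<Psi> 0 j = \<Phi> j) \<and>
     transparent_bc (conv_s (conv_R hbar m dx dt) 0)
       (omega_0 hbar m QIL k dt) dt 0 1 \<Phi> \<Psi> \<and>
     transparent_bc (conv_s (conv_R hbar m dx dt) (conv_sigma hbar m dx QL))
       (omega_L hbar m QIL QL k dt) dt J (J - 1) \<Phi> \<Psi>"

subsection \<open>Discrete norms\<close>

definition norm_2 :: "nat \<Rightarrow> real \<Rightarrow> (nat \<Rightarrow> complex) \<Rightarrow> real" where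
  "norm_2 J dx u = sqrt (\<Sum>j\<in>{1..<J}. (cmod (u j))\<^sup>2 * dx)"

text \<open>Inserting \<open>0\<close> only matters for \<open>J = 1\<close>, where there is no interior node.\<close>
definition norm_inf :: "nat \<Rightarrow> (nat \<Rightarrow> real) \<Rightarrow> real" where
  "norm_inf J q = Max (insert 0 ((\<lambda>j. \<bar>q j\<bar>) ` {1..<J}))"

end

theory Submission
  imports Defs
begin

text \<open>
  The only incoming waves are the plane waves that drive the stationary state \<open>\<Phi>\<close>. At the left end
  \<open>\<Psi> - \<Phi> e\<^sub>0\<close> and at the right end \<open>\<Psi> - \<Phi> e\<^sub>L\<close> satisfy homogeneous transparent boundary
  conditions, where \<open>e\<^sub>0\<close> and \<open>e\<^sub>L\<close> are the oscillations in time with angular frequencies \<open>\<omega>\<^sub>0\<close> and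
  \<open>\<omega>\<^sub>L\<close>. Let \<open>\<tau>\<close> be a smooth transition from 0 to 1 on the interval. Then
  \<open>w = \<Psi> - \<Phi> (e\<^sub>0 + \<tau> (e\<^sub>L - e\<^sub>0))\<close> vanishes initially and solves the Crank-Nicolson scheme with a
  source. Linear growth of its norm with the elapsed time follows from three facts.

  The first is that homogeneous transparent boundary conditions are dissipative
  (\<open>transparent_dissipation\<close>). The generating function of the convolution coefficients is computed
  from that of the Legendre polynomials (\<open>leg_series_square\<close>) and yields the root of the quadratic
  equation of the exterior scheme that decays in space (\<open>conv_s_root\<close>, \<open>conv_s_decaying_root\<close>).
  The powers of this root extend the solution to the exterior domain, where the energy balance
  telescopes. Everything is done with formal power series; no convergence in the frequency variable
  is used.

  The second is the energy identity of the scheme. The potential is real and drops out; what remains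
  is the source (\<open>discrete_energy_estimate\<close>).

  The third is a bound for the source, uniform in the grid (\<open>lift_residual_bound\<close>). It needs pointwise
  bounds for \<open>\<Phi>\<close> and its difference quotients (\<open>stationary_bounds\<close>). Conservation of the discrete
  flux shows that the reflection coefficient is at most one in modulus, which bounds the data at the
  incoming end, and a discrete Gronwall argument propagates the bound (\<open>scattering_bound\<close>). The
  potential enters the source only through its maximum.

  The transition \<open>\<tau>\<close> need not be constant near the ends: it is quadratically flat there, the resulting
  sources in the boundary conditions are as small as the interior ones, and the dissipation inequality
  also controls the boundary values against which they act.
\<close>

section \<open>The generating function of the Legendre polynomials\<close>

text \<open>
  The coefficients of the power series of \<open>- sqrt (1 - 2 x z + z\<^sup>2)\<close> in \<open>z\<close>, written as
  they occur in the convolution coefficients; at \<open>l = 0\<close> the value is \<open>1 / (-1) = -1\<close>.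
\<close>
definition leg_coeff :: "real \<Rightarrow> nat \<Rightarrow> real" where
  "leg_coeff x l = (legendre_int (int l) x - legendre_int (int l - 2) x) / (2 * real l - 1)"

lemma legendre_bonnet:
  "(real n + 2) * legendre (Suc (Suc n)) x
     = (2 * real n + 3) * x * legendre (Suc n) x - (real n + 1) * legendre n x"
  by simp

lemma leg_coeff_0: "leg_coeff x 0 = -1"
  and leg_coeff_1: "leg_coeff x (Suc 0) = x"
  and leg_coeff_Suc_Suc:
    "leg_coeff x (Suc (Suc n)) = (legendre (Suc (Suc n)) x - legendre n x) / (2 * real n + 3)"
proof -
  have "nat (int (Suc (Suc n))) = Suc (Suc n)" "nat (int n) = n" by simp_all
  moreover have "int (Suc (Suc n)) - 2 = int n" by simp
  ultimately show "leg_coeff x (Suc (Suc n)) = (legendre (Suc (Suc n)) x - legendre n x) / (2 * real n + 3)"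
    unfolding leg_coeff_def legendre_int_def by (simp del: legendre.simps add: algebra_simps)
qed (simp_all add: leg_coeff_def legendre_int_def)

lemma leg_coeff_alt:
  "(real n + 2) * leg_coeff x (Suc (Suc n)) = x * legendre (Suc n) x - legendre n x"
proof -
  have "(real n + 2) * (legendre (Suc (Suc n)) x - legendre n x)
      = (2 * real n + 3) * (x * legendre (Suc n) x - legendre n x)"
    using legendre_bonnet[of n x] by (simp add: algebra_simps del: legendre.simps)
  moreover have "2 * real n + 3 \<noteq> 0" by linarith
  ultimately show ?thesis
    by (simp add: leg_coeff_Suc_Suc nonzero_divide_eq_eq mult.commute del: legendre.simps)
qed

text \<open>
  This recursion is the coefficient form of the differential equation
  \<open>(1 - 2 x z + z\<^sup>2) q' = (z - x) q\<close> of \<open>q = - sqrt (1 - 2 x z + z\<^sup>2)\<close>.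
\<close>
lemma leg_coeff_rec:
  "(real n + 2) * leg_coeff x (Suc (Suc n))
     = (2 * real n + 1) * x * leg_coeff x (Suc n) - (real n - 1) * leg_coeff x n"
proof -
  consider "n = 0" | "n = 1" | p where "n = Suc (Suc p)"
    by (metis One_nat_def not0_implies_Suc)
  then show ?thesis
  proof cases
    case 1
    then show ?thesis by (simp add: leg_coeff_alt[of 0, simplified] leg_coeff_0 leg_coeff_1)
  next
    case 2
    then show ?thesis
      using leg_coeff_alt[of 1 x]
      by (simp add: leg_coeff_Suc_Suc field_simps numeral_2_eq_2 del: legendre.simps(3))
  next
    case 3
    have p: "2 * real p + 3 \<noteq> 0" "2 * real p + 5 \<noteq> 0" by linarith+
    have lc: "(2 * real p + 5) * leg_coeff x (Suc n) = legendre (Suc n) x - legendre (Suc p) x"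
      using p(2) 3 by (simp add: leg_coeff_Suc_Suc nonzero_mult_div_cancel_left add.commute del: legendre.simps)
    have "(2 * real n + 1) * x * leg_coeff x (Suc n) = x * ((2 * real p + 5) * leg_coeff x (Suc n))"
      using 3 by (simp add: algebra_simps)
    then have A: "(2 * real n + 1) * x * leg_coeff x (Suc n) = x * legendre (Suc n) x - x * legendre (Suc p) x"
      unfolding lc by (simp only: right_diff_distrib)
    have "(2 * real p + 3) * ((real p + 1) * leg_coeff x n)
        = (real p + 1) * (legendre n x - legendre p x)"
      using p 3 by (simp add: leg_coeff_Suc_Suc del: legendre.simps)
    also have "\<dots> = (2 * real p + 3) * (legendre n x - x * legendre (Suc p) x)"
      using legendre_bonnet[of p x] 3 by (simp add: algebra_simps del: legendre.simps)
    finally have "(real p + 1) * leg_coeff x n = legendre n x - x * legendre (Suc p) x"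
      using p by (simp only: mult_cancel_left) simp
    then have B: "(real n - 1) * leg_coeff x n = legendre n x - x * legendre (Suc p) x"
      using 3 by (simp add: add.commute del: legendre.simps)
    show ?thesis
      unfolding leg_coeff_alt A B by simp
  qed
qed

lemma fps_eq_if_log_deriv_eq:
  fixes p w :: "complex fps"
  assumes eq: "fps_deriv p * w = p * fps_deriv w" and p0: "fps_nth p 0 = 1" and w0: "fps_nth w 0 = 1"
  shows "p = w"
proof -
  define v where "v = inverse w"
  have wv: "w * v = 1" unfolding v_def using w0 by (simp add: inverse_mult_eq_1')
  have w_nz: "w \<noteq> 0" using w0 by auto
  have "fps_deriv (w * v) = 0" unfolding wv by simp
  then have v': "w * fps_deriv v = - fps_deriv w * v" by (simp add: add_eq_0_iff)
  have "w * fps_deriv (p * v) = p * (w * fps_deriv v) + (fps_deriv p * w) * v"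
    by (simp add: algebra_simps)
  also have "\<dots> = 0" unfolding v' eq by simp
  finally have "fps_deriv (p * v) = 0" using w_nz by simp
  then have "p * v = fps_const (fps_nth (p * v) 0)" by (simp only: fps_deriv_eq_0_iff)
  also have "fps_nth (p * v) 0 = 1" using p0 w0 by (simp add: v_def)
  finally have "(p * v) * w = w" by simp
  moreover have "(p * v) * w = p * (w * v)" by (simp only: mult_ac)
  ultimately show ?thesis using wv by simp
qed

text \<open>
  The rotated variable \<open>c z\<close> stands for the factor \<open>e\<^sup>-\<^sup>i\<^sup>\<phi>\<close> per time step in the convolution
  coefficients. Both sides have the same logarithmic derivative and constant term 1.
\<close>
lemma leg_series_square:
  fixes c :: complex and x :: real
  defines "q \<equiv> Abs_fps (\<lambda>l. of_real (leg_coeff x l) * c ^ l)"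
  shows "q\<^sup>2 = 1 - fps_const (2 * of_real x * c) * fps_X + fps_const (c\<^sup>2) * fps_X\<^sup>2"
proof -
  let ?W = "1 - fps_const (2 * of_real x * c) * fps_X + fps_const (c\<^sup>2) * fps_X\<^sup>2 :: complex fps"
  let ?Z = "fps_const (c\<^sup>2) * fps_X - fps_const (of_real x * c) :: complex fps"
  have ode: "?W * fps_deriv q = ?Z * q"
  proof (rule fps_ext)
    fix n
    have W: "?W * fps_deriv q = fps_deriv q - fps_const (2 * of_real x * c) * (fps_X * fps_deriv q)
        + fps_const (c\<^sup>2) * (fps_X\<^sup>2 * fps_deriv q)"
      by (simp add: algebra_simps)
    have Z: "?Z * q = fps_const (c\<^sup>2) * (fps_X * q) - fps_const (of_real x * c) * q"
      by (simp add: algebra_simps)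
    consider "n = 0" | "n = 1" | p where "n = Suc (Suc p)"
      by (metis One_nat_def not0_implies_Suc)
    then show "fps_nth (?W * fps_deriv q) n = fps_nth (?Z * q) n"
    proof cases
      case 1
      then show ?thesis unfolding W Z
        by (simp add: q_def leg_coeff_0 leg_coeff_1 fps_X_power_mult_nth)
    next
      case 2
      have "complex_of_real ((real 0 + 2) * leg_coeff x (Suc (Suc 0)))
          = of_real ((2 * real 0 + 1) * x * leg_coeff x (Suc 0) - (real 0 - 1) * leg_coeff x 0)"
        using leg_coeff_rec[of 0 x] by simp
      then have lc2: "complex_of_real (leg_coeff x (Suc (Suc 0))) = (of_real x * of_real x - 1) / 2"
        by (simp add: leg_coeff_0 leg_coeff_1 field_simps)
      from 2 show ?thesis unfolding W Z
        by (simp add: q_def leg_coeff_0 leg_coeff_1 lc2 fps_X_power_mult_nth) (simp add: algebra_simps power2_eq_square)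
    next
      case 3
      have "complex_of_real ((real (Suc p) + 2) * leg_coeff x (Suc (Suc (Suc p))))
          = of_real ((2 * real (Suc p) + 1) * x * leg_coeff x (Suc (Suc p)) - (real (Suc p) - 1) * leg_coeff x (Suc p))"
        using leg_coeff_rec[of "Suc p" x] by simp
      then have "(of_nat p + 3) * complex_of_real (leg_coeff x (Suc (Suc (Suc p))))
          = (2 * of_nat p + 3) * of_real x * of_real (leg_coeff x (Suc (Suc p))) - of_nat p * of_real (leg_coeff x (Suc p))"
        by (simp add: algebra_simps)
      then have rec: "(of_nat p + 3) * complex_of_real (leg_coeff x (Suc (Suc (Suc p))))
          - (2 * of_nat p + 3) * of_real x * of_real (leg_coeff x (Suc (Suc p)))
          + of_nat p * of_real (leg_coeff x (Suc p)) = 0" by simp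
      have factor: "(3 + P) * (a3 * (c * (c * (c * d)))) - 2 * y * c * ((2 + P) * (a2 * (c * (c * d))))
            + c\<^sup>2 * ((1 + P) * (a1 * (c * d)))
          = c\<^sup>2 * (a1 * (c * d)) - y * c * (a2 * (c * (c * d)))
            + ((P + 3) * a3 - (2 * P + 3) * y * a2 + P * a1) * (c * (c * (c * d)))"
        for P a1 a2 a3 y d :: complex
        by (simp add: algebra_simps power2_eq_square)
      from 3 show ?thesis unfolding W Z
        by (simp add: q_def fps_X_power_mult_nth factor rec)
    qed
  qed
  have W': "fps_deriv ?W = 2 * ?Z"
  proof -
    have "fps_deriv (1 - 2 * fps_const a * fps_X + fps_const b * fps_X\<^sup>2)
        = 2 * (fps_const b * fps_X - fps_const a)" for a b :: complex
      by (simp add: power2_eq_square algebra_simps)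
    moreover have "fps_const (2 * of_real x * c) = 2 * fps_const (of_real x * c)"
      by (simp add: numeral_fps_const mult.assoc)
    ultimately show ?thesis by (simp only:)
  qed
  have "fps_deriv (q\<^sup>2) * ?W = q\<^sup>2 * fps_deriv ?W"
  proof -
    have "fps_deriv (f\<^sup>2) * w = 2 * f * (w * fps_deriv f)" for f w :: "complex fps"
      by (simp add: power2_eq_square algebra_simps)
    then have "fps_deriv (q\<^sup>2) * ?W = 2 * q * (?W * fps_deriv q)" .
    then show ?thesis unfolding ode W' by (simp only: power2_eq_square mult_ac)
  qed
  then show ?thesis
    by (rule fps_eq_if_log_deriv_eq)
      (simp_all add: q_def leg_coeff_0 fps_power_zeroth)
qed

section \<open>The convolution coefficients and the decaying exterior root\<close>

text \<open>
  In an exterior domain the Crank-Nicolson scheme reads, for the generating functions \<open>V\<^sub>j\<close> in time,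
  \<open>(1 + X) (V\<^sub>j\<^sub>+\<^sub>1 + V\<^sub>j\<^sub>-\<^sub>1) = 2 B V\<^sub>j\<close>. This definition is the symbol \<open>B\<close>.
\<close>
definition exterior_symbol :: "real \<Rightarrow> real \<Rightarrow> complex fps" where
  "exterior_symbol R \<sigma> = fps_const (Complex (1 + \<sigma> / 2) (- R / 2))
     + fps_const (Complex (1 + \<sigma> / 2) (R / 2)) * fps_X"

text \<open>
  The complex number whose argument is \<open>conv_phi\<close> has the modulus that occurs in \<open>conv_mu\<close>
  and \<open>conv_a\<close>.
\<close>
lemma conv_symbol_abs:
  fixes R \<sigma> :: real
  shows "(cmod (Complex (R\<^sup>2 - 4 * \<sigma> - \<sigma>\<^sup>2) (2 * R * (\<sigma> + 2))))\<^sup>2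
    = (R\<^sup>2 + \<sigma>\<^sup>2) * (R\<^sup>2 + (\<sigma> + 4)\<^sup>2)"
  unfolding cmod_power2 by (simp add: power2_eq_square algebra_simps)

lemma conv_a_square:
  "(conv_a R \<sigma>)\<^sup>2 = - Complex (R\<^sup>2 - 4 * \<sigma> - \<sigma>\<^sup>2) (2 * R * (\<sigma> + 2)) / 4"
proof -
  let ?c = "Complex (R\<^sup>2 - 4 * \<sigma> - \<sigma>\<^sup>2) (2 * R * (\<sigma> + 2))"
  let ?p = "(R\<^sup>2 + \<sigma>\<^sup>2) * (R\<^sup>2 + (\<sigma> + 4)\<^sup>2)"
  have "(root 4 ?p)\<^sup>2 = sqrt ?p"
  proof (rule real_sqrt_unique[symmetric])
    have "((root 4 ?p)\<^sup>2)\<^sup>2 = root 4 ?p ^ 4" by (simp flip: power_mult)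
    then show "((root 4 ?p)\<^sup>2)\<^sup>2 = ?p" by simp
  qed simp
  also have "\<dots> = cmod ?c"
    by (rule real_sqrt_unique) (simp_all only: conv_symbol_abs norm_ge_zero)
  finally have r: "(root 4 ?p)\<^sup>2 = cmod ?c" .
  have "(exp (\<i> * of_real (conv_phi R \<sigma> / 2)))\<^sup>2 = exp (\<i> * of_real (conv_phi R \<sigma>))"
    by (simp flip: exp_of_nat_mult)
  then have "(conv_a R \<sigma>)\<^sup>2 = - (of_real ((root 4 ?p)\<^sup>2) * exp (\<i> * of_real (Arg ?c))) / 4"
    unfolding conv_a_def conv_phi_def by (simp add: power_mult_distrib power_divide del: of_real_mult)
  also have "\<dots> = - (of_real (cmod ?c) * exp (\<i> * of_real (Arg ?c))) / 4" unfolding r ..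
  also have "of_real (cmod ?c) * exp (\<i> * of_real (Arg ?c)) = ?c"
    using Arg_eq[of ?c] by (cases "?c = 0") auto
  finally show ?thesis .
qed

lemma conv_s_fps:
  "Abs_fps (conv_s R \<sigma>) = exterior_symbol R \<sigma> + fps_const (conv_a R \<sigma>) *
     Abs_fps (\<lambda>l. of_real (leg_coeff (conv_mu R \<sigma>) l) * exp (- \<i> * of_real (conv_phi R \<sigma>)) ^ l)"
proof (rule fps_ext)
  fix n
  have e: "exp (- \<i> * of_real (real n * conv_phi R \<sigma>)) = exp (- \<i> * of_real (conv_phi R \<sigma>)) ^ n"
    by (simp add: algebra_simps flip: exp_of_nat_mult)
  consider "n = 0" | "n = 1" | "n > 1" by linarith
  then show "fps_nth (Abs_fps (conv_s R \<sigma>)) n = fps_nth (exterior_symbol R \<sigma> + fps_const (conv_a R \<sigma>) *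
     Abs_fps (\<lambda>l. of_real (leg_coeff (conv_mu R \<sigma>) l) * exp (- \<i> * of_real (conv_phi R \<sigma>)) ^ l)) n"
    unfolding fps_nth_Abs_fps conv_s_def e leg_coeff_def exterior_symbol_def
    by cases (simp_all add: complex_eq_iff algebra_simps)
qed

text \<open>
  The generating function \<open>s\<close> of the convolution coefficients solves
  \<open>s\<^sup>2 - 2 B s + (1 + X)\<^sup>2 = 0\<close>. Hence \<open>s / (1 + X)\<close> and \<open>(2 B - s) / (1 + X)\<close> are mutually inverse
  and are the two spatial growth factors of the exterior scheme.
\<close>
lemma conv_s_root:
  fixes R \<sigma> :: real
  defines "s \<equiv> Abs_fps (conv_s R \<sigma>)" and "B \<equiv> exterior_symbol R \<sigma>"
  shows "s * (2 * B - s) = (1 + fps_X)\<^sup>2"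
proof -
  let ?c = "Complex (R\<^sup>2 - 4 * \<sigma> - \<sigma>\<^sup>2) (2 * R * (\<sigma> + 2))"
  let ?e = "exp (- \<i> * of_real (conv_phi R \<sigma>))"
  let ?mu = "conv_mu R \<sigma>"
  define q where "q = Abs_fps (\<lambda>l. of_real (leg_coeff ?mu l) * ?e ^ l)"
  have sq: "s = B + fps_const (conv_a R \<sigma>) * q"
    unfolding s_def B_def q_def by (rule conv_s_fps)
  have abs_c: "cmod ?c = sqrt ((R\<^sup>2 + \<sigma>\<^sup>2) * (R\<^sup>2 + (\<sigma> + 4)\<^sup>2))"
    by (rule real_sqrt_unique[symmetric]) (simp_all only: conv_symbol_abs norm_ge_zero)
  have mu: "of_real ?mu * of_real (cmod ?c) = complex_of_real (R\<^sup>2 + 4 * \<sigma> + \<sigma>\<^sup>2)"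
  proof (cases "cmod ?c = 0")
    case True
    then have "R\<^sup>2 + \<sigma>\<^sup>2 = 0 \<or> R\<^sup>2 + (\<sigma> + 4)\<^sup>2 = 0"
      using conv_symbol_abs[of R \<sigma>] by simp
    then have "R = 0 \<and> (\<sigma> = 0 \<or> \<sigma> + 4 = 0)"
      by (simp only: sum_power2_eq_zero_iff) blast
    then have "R\<^sup>2 + 4 * \<sigma> + \<sigma>\<^sup>2 = 0"
      by (auto simp: add_eq_0_iff2 eq_neg_iff_add_eq_0[symmetric])
    then show ?thesis using True by simp
  next
    case False
    then show ?thesis unfolding conv_mu_def abs_c by (simp flip: of_real_mult)
  qed
  have c: "?c = of_real (cmod ?c) * exp (\<i> * of_real (conv_phi R \<sigma>))"
    unfolding conv_phi_def using Arg_eq[of ?c] by (cases "?c = 0") auto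
  have ce: "?c * ?e = of_real (cmod ?c)"
    by (subst c) (simp add: exp_minus_inverse mult.assoc flip: exp_add)
  have "cnj ?c = of_real (cmod ?c) * ?e"
    by (subst c) (simp add: exp_cnj)
  then have cee: "?c * ?e\<^sup>2 = cnj ?c" using ce by (simp add: power2_eq_square flip: mult.assoc)
  have quadratic_scale: "a * (1 - f * X + g * X\<^sup>2) = a - (a * f) * X + (a * g) * X\<^sup>2"
    and quadratic_diff: "(b + d * X)\<^sup>2 - (1 + X)\<^sup>2 = (b\<^sup>2 - 1) + (2 * b * d - 2) * X + (d\<^sup>2 - 1) * X\<^sup>2"
    for a b d f g X :: "complex fps"
    by (simp_all add: power2_eq_square algebra_simps)
  let ?b = "Complex (1 + \<sigma> / 2) (- R / 2)" and ?d = "Complex (1 + \<sigma> / 2) (R / 2)"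
  have b2: "?b\<^sup>2 - 1 = - ?c / 4" and d2: "?d\<^sup>2 - 1 = - cnj ?c / 4"
    and bd: "2 * ?b * ?d - 2 = - (- ?c / 4 * (2 * of_real ?mu * ?e))"
  proof -
    have "- (- ?c / 4 * (2 * of_real ?mu * ?e)) = of_real ((R\<^sup>2 + 4 * \<sigma> + \<sigma>\<^sup>2) / 2)"
      using mu ce by (simp add: field_simps)
    then show "2 * ?b * ?d - 2 = - (- ?c / 4 * (2 * of_real ?mu * ?e))"
      by (simp add: complex_eq_iff power2_eq_square field_simps)
  qed (simp_all add: complex_eq_iff power2_eq_square field_simps)
  have "(s - B)\<^sup>2 = (fps_const (conv_a R \<sigma>))\<^sup>2 * q\<^sup>2"
    unfolding sq by (simp add: power_mult_distrib)
  also have "q\<^sup>2 = 1 - fps_const (2 * of_real ?mu * ?e) * fps_X + fps_const (?e\<^sup>2) * fps_X\<^sup>2"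
    unfolding q_def by (rule leg_series_square)
  also have "(fps_const (conv_a R \<sigma>))\<^sup>2 * \<dots> = fps_const (- ?c / 4)
      - fps_const (- ?c / 4 * (2 * of_real ?mu * ?e)) * fps_X + fps_const (- ?c / 4 * ?e\<^sup>2) * fps_X\<^sup>2"
    unfolding fps_const_power conv_a_square quadratic_scale fps_const_mult ..
  also have "\<dots> = fps_const (?b\<^sup>2 - 1) + fps_const (2 * ?b * ?d - 2) * fps_X
       + fps_const (?d\<^sup>2 - 1) * fps_X\<^sup>2"
  proof -
    have "- ?c / 4 * ?e\<^sup>2 = - cnj ?c / 4" using cee by simp
    then show ?thesis unfolding b2 d2 bd by (simp only: fps_const_neg[symmetric]) simp
  qed
  also have "\<dots> = B\<^sup>2 - (1 + fps_X)\<^sup>2"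
    unfolding B_def exterior_symbol_def quadratic_diff
    by (simp only: fps_const_power fps_const_mult fps_const_sub numeral_fps_const fps_const_1_eq_1[symmetric])
  finally show ?thesis by (simp add: power2_eq_square algebra_simps)
qed

text \<open>
  The choice of branch in \<open>conv_a\<close> makes \<open>(2 B - s) / (1 + X)\<close> the factor that decays away from
  the boundary. The product of the two constant terms is 1, so it is enough to compare their
  moduli, which is decided by the sign of a real part.
\<close>
lemma conv_s_decaying_root:
  assumes "R > 0"
  shows "cmod (fps_nth (2 * exterior_symbol R \<sigma> - Abs_fps (conv_s R \<sigma>)) 0) < 1"
proof -
  let ?c = "Complex (R\<^sup>2 - 4 * \<sigma> - \<sigma>\<^sup>2) (2 * R * (\<sigma> + 2))"
  let ?b = "Complex (1 + \<sigma> / 2) (- R / 2)"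
  let ?phi = "conv_phi R \<sigma>"
  define a where "a = conv_a R \<sigma>"
  define r where "r = root 4 ((R\<^sup>2 + \<sigma>\<^sup>2) * (R\<^sup>2 + (\<sigma> + 4)\<^sup>2)) / 2"
  have r: "r > 0" unfolding r_def using assms by (simp add: add_pos_nonneg)
  have a: "a = Complex (- r * sin (?phi / 2)) (r * cos (?phi / 2))"
    unfolding a_def conv_a_def r_def by (simp add: complex_eq_iff Re_exp Im_exp)
  have phi: "- pi < ?phi" "?phi < pi"
  proof -
    show "- pi < ?phi" unfolding conv_phi_def using Arg_bounded by blast
    have "?phi \<noteq> pi"
    proof
      assume "?phi = pi"
      then have "Re ?c < 0" "Im ?c = 0" unfolding conv_phi_def Arg_eq_pi by auto
      then have "\<sigma> = - 2" "R\<^sup>2 - 4 * \<sigma> - \<sigma>\<^sup>2 < 0" using assms by auto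
      then show False using zero_le_power2[of R] by simp
    qed
    then show "?phi < pi" unfolding conv_phi_def using Arg_bounded[of ?c] by linarith
  qed
  have cos: "cos (?phi / 2) > 0" using phi by (intro cos_gt_zero_pi) auto
  have sin: "(\<sigma> + 2) * sin (?phi / 2) \<ge> 0"
  proof (cases "\<sigma> + 2 \<ge> 0")
    case True
    then have "Im ?c \<ge> 0" using assms by simp
    then have "?phi \<ge> 0" unfolding conv_phi_def by (simp add: Arg_less_0)
    then show ?thesis using True phi by (intro mult_nonneg_nonneg sin_ge_zero) auto
  next
    case False
    then have "Im ?c < 0" using assms by (simp add: mult_less_0_iff)
    then have "?phi < 0" unfolding conv_phi_def using Arg_less_0[of ?c] by linarith
    then have "sin (?phi / 2) \<le> 0" using phi sin_ge_zero[of "- ?phi / 2"] by simp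
    then show ?thesis using False by (intro mult_nonpos_nonpos) auto
  qed
  have "Re (cnj ?b * a) = - (r / 2) * ((\<sigma> + 2) * sin (?phi / 2)) - (r * R / 2) * cos (?phi / 2)"
    unfolding a by (simp add: algebra_simps)
  moreover have "(r / 2) * ((\<sigma> + 2) * sin (?phi / 2)) \<ge> 0" "(r * R / 2) * cos (?phi / 2) > 0"
    using r assms by (intro mult_nonneg_nonneg[OF _ sin] mult_pos_pos[OF _ cos]; simp)+
  ultimately have neg: "Re (cnj ?b * a) < 0" by linarith
  \<comment> \<open>The two constant terms are \<open>?b - a\<close> (of \<open>s\<close>) and \<open>?b + a\<close> (of \<open>2 B - s\<close>).\<close>
  have "(cmod (?b + a))\<^sup>2 - (cmod (?b - a))\<^sup>2 = 4 * Re (cnj ?b * a)"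
    unfolding cmod_power2 by (simp add: power2_eq_square algebra_simps)
  then have "(cmod (?b + a))\<^sup>2 < (cmod (?b - a))\<^sup>2" using neg by linarith
  then have less: "cmod (?b + a) < cmod (?b - a)" by (simp add: power_less_imp_less_base)
  have s0: "conv_s R \<sigma> 0 = ?b - a"
    unfolding conv_s_def a_def by (simp add: legendre_int_def complex_eq_iff)
  have "fps_nth (Abs_fps (conv_s R \<sigma>) * (2 * exterior_symbol R \<sigma> - Abs_fps (conv_s R \<sigma>))) 0 = 1"
    unfolding conv_s_root by (simp add: power2_eq_square)
  then have "(?b - a) * (2 * ?b - (?b - a)) = 1"
    using s0 by (simp add: exterior_symbol_def numeral_fps_const)
  then have "(?b - a) * (?b + a) = 1" by simp
  then have prod: "cmod (?b - a) * cmod (?b + a) = 1" by (metis norm_mult norm_one)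
  have "cmod (?b + a) < 1"
  proof (rule ccontr)
    assume "\<not> ?thesis"
    then have "1 \<le> cmod (?b + a)" "1 < cmod (?b - a)" using less by auto
    then have "1 * 1 < cmod (?b - a) * cmod (?b + a)" by (intro mult_less_le_imp_less) auto
    then show False using prod by simp
  qed
  moreover have "fps_nth (2 * exterior_symbol R \<sigma> - Abs_fps (conv_s R \<sigma>)) 0 = ?b + a"
    using s0 by (simp add: exterior_symbol_def numeral_fps_const)
  ultimately show ?thesis by simp
qed

section \<open>Dissipativity of transparent boundary conditions\<close>

lemma geometric_bound_recurrence:
  fixes a b :: "nat \<Rightarrow> complex"
  assumes rec: "\<And>K. a (Suc K) = c * a K + b K"
    and q: "cmod c < q"
    and b: "\<And>K. cmod (b K) \<le> D * q ^ K"
  shows "\<exists>C. \<forall>K. cmod (a K) \<le> C * q ^ K"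
proof -
  define C where "C = max (cmod (a 0)) (D / (q - cmod c))"
  have q0: "q > 0" using q norm_ge_zero[of c] by linarith
  have "D / (q - cmod c) \<le> C" by (simp add: C_def)
  then have C: "cmod c * C + D \<le> C * q" using q by (simp add: field_simps)
  have "cmod (a K) \<le> C * q ^ K" for K
  proof (induction K)
    case 0
    then show ?case by (simp add: C_def)
  next
    case (Suc K)
    have "cmod (a (Suc K)) \<le> cmod c * cmod (a K) + cmod (b K)"
      unfolding rec by (metis norm_mult norm_triangle_ineq)
    also have "\<dots> \<le> cmod c * (C * q ^ K) + D * q ^ K"
      by (intro add_mono mult_left_mono Suc b norm_ge_zero)
    also have "\<dots> = (cmod c * C + D) * q ^ K" by (simp add: algebra_simps)
    also have "\<dots> \<le> (C * q) * q ^ K" using C q0 by (intro mult_right_mono) auto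
    finally show ?case by (simp add: mult.assoc)
  qed
  then show ?thesis by blast
qed

text \<open>
  Powers of a series with constant term inside the unit disc tend to zero coefficientwise. This
  is the decay at spatial infinity of the exterior solution.
\<close>
lemma fps_power_coeff_tendsto_0:
  fixes y u :: "complex fps"
  assumes "cmod (fps_nth y 0) < 1"
  shows "(\<lambda>K. fps_nth (y ^ K * u) n) \<longlonglongrightarrow> 0"
proof -
  obtain q where q: "cmod (fps_nth y 0) < q" "q < 1" using assms dense by blast
  have q0: "q > 0" using q norm_ge_zero[of "fps_nth y 0"] by linarith
  have "\<exists>C. \<forall>K. cmod (fps_nth (y ^ K * u) n) \<le> C * q ^ K" for n
  proof (induction n rule: less_induct)
    case (less n)
    then obtain C where C: "\<And>i K. i < n \<Longrightarrow> cmod (fps_nth (y ^ K * u) i) \<le> C i * q ^ K"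
      by metis
    define b where "b K = (\<Sum>i<n. fps_nth (y ^ K * u) i * fps_nth y (n - i))" for K
    have rec: "fps_nth (y ^ Suc K * u) n = fps_nth y 0 * fps_nth (y ^ K * u) n + b K" for K
    proof -
      have "y ^ Suc K * u = (y ^ K * u) * y" by (simp add: algebra_simps)
      then show ?thesis
        by (simp only: fps_mult_nth b_def atLeast0AtMost lessThan_Suc_atMost[symmetric] sum.lessThan_Suc) simp
    qed
    have b: "cmod (b K) \<le> (\<Sum>i<n. C i * cmod (fps_nth y (n - i))) * q ^ K" for K
    proof -
      have "cmod (b K) \<le> (\<Sum>i<n. cmod (fps_nth (y ^ K * u) i) * cmod (fps_nth y (n - i)))"
        unfolding b_def by (rule order_trans[OF norm_sum]) (simp add: norm_mult)
      also have "\<dots> \<le> (\<Sum>i<n. (C i * q ^ K) * cmod (fps_nth y (n - i)))"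
        by (intro sum_mono mult_right_mono C) auto
      finally show ?thesis by (simp add: sum_distrib_right sum_distrib_left mult_ac)
    qed
    show ?case
      using geometric_bound_recurrence[where a = "\<lambda>K. fps_nth (y ^ K * u) n", OF rec q(1) b] .
  qed
  then obtain C where C: "\<And>K. cmod (fps_nth (y ^ K * u) n) \<le> C * q ^ K" by blast
  have "(\<lambda>K. C * q ^ K) \<longlonglongrightarrow> C * 0"
    using q q0 by (intro tendsto_intros LIMSEQ_realpow_zero) auto
  then have "(\<lambda>K. C * q ^ K) \<longlonglongrightarrow> 0" by simp
  then show ?thesis
    by (rule Lim_null_comparison[rotated]) (rule always_eventually, rule allI, rule C)
qed

lemma flux_telescope:
  fixes H :: "nat \<Rightarrow> complex"
  shows "(\<Sum>j\<in>{1..<Suc K}. Im (cnj (H j) * (H (j + 1) + H (j - 1))))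
     = Im (cnj (H K) * H (Suc K)) - Im (cnj (H 0) * H 1)"
  by (induction K) (simp_all add: algebra_simps)

text \<open>
  The homogeneous transparent boundary condition for the boundary values \<open>u\<close> and the values \<open>v\<close>
  at the adjacent interior node never lets energy in, and it controls \<open>u\<close>. With \<open>y\<close> the decaying
  root, the condition says \<open>U = y V\<close>, so that \<open>E\<^sub>j = y\<^sup>j V\<close> extends \<open>v, u\<close> to a solution of the
  exterior scheme that decays in space. Summing the local energy balance over the exterior nodes
  expresses the flux through the boundary by the exterior energy.
\<close>
lemma transparent_dissipation:
  fixes u v :: "nat \<Rightarrow> complex"
  assumes R: "R > 0" and u0: "u 0 = 0" and v0: "v 0 = 0"
    and bc: "\<And>l. l \<ge> 1 \<Longrightarrow> v l - conv_s R \<sigma> 0 * u l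
       = (\<Sum>p\<in>{1..<l}. conv_s R \<sigma> (l - p) * u p) - v (l - 1)"
  shows "(\<Sum>l<n. Im (cnj (u (Suc l) + u l) * (v (Suc l) + v l))) \<le> - R * (cmod (u n))\<^sup>2"
proof -
  define U where "U = Abs_fps u"
  define V where "V = Abs_fps v"
  define s where "s = Abs_fps (conv_s R \<sigma>)"
  define B where "B = exterior_symbol R \<sigma>"
  define X1 :: "complex fps" where "X1 = 1 + fps_X"
  have X1_nth: "fps_nth (X1 * f) (Suc l) = fps_nth f (Suc l) + fps_nth f l" for f l
    by (simp add: X1_def algebra_simps)
  have X1_0: "fps_nth X1 0 = 1" by (simp add: X1_def)
  have X1_inv: "X1 * inverse X1 = 1"
    by (metis X1_0 inverse_mult_eq_1' zero_neq_one)
  have X1_nz: "X1 \<noteq> 0" using X1_0 by auto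
  have "X1 * V = s * U"
  proof (rule fps_ext)
    fix l show "fps_nth (X1 * V) l = fps_nth (s * U) l"
    proof (cases l)
      case 0
      then show ?thesis by (simp add: U_def V_def u0 v0)
    next
      case (Suc l')
      have "fps_nth (s * U) l = (\<Sum>p=0..l. conv_s R \<sigma> (l - p) * u p)"
        unfolding mult.commute[of s U] by (simp add: fps_mult_nth s_def U_def mult.commute)
      also have "{0..l} = insert 0 (insert l {1..<l})" using Suc by auto
      also have "(\<Sum>p\<in>\<dots>. conv_s R \<sigma> (l - p) * u p)
          = conv_s R \<sigma> 0 * u l + (\<Sum>p\<in>{1..<l}. conv_s R \<sigma> (l - p) * u p)"
        using Suc u0 by simp
      also have "\<dots> = v l + v (l - 1)" using bc[of l] Suc by (simp add: algebra_simps)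
      finally show ?thesis using Suc by (simp add: X1_nth V_def)
    qed
  qed
  define y where "y = (2 * B - s) * inverse X1"
  have X1y: "X1 * y = 2 * B - s" unfolding y_def using X1_inv
    by (metis mult.assoc mult.commute mult.right_neutral)
  have root: "s * (2 * B - s) = X1\<^sup>2"
    unfolding s_def B_def X1_def by (rule conv_s_root)
  then have "X1 * (s * y) = X1 * X1" using X1y by (metis mult.left_commute power2_eq_square)
  then have sy: "s * y = X1" using X1_nz by simp
  have quad: "X1 * (y\<^sup>2 + 1) = 2 * B * y"
  proof -
    have "X1 * (y\<^sup>2 + 1) = (X1 * y) * y + X1" by (simp add: power2_eq_square algebra_simps)
    also have "\<dots> = (2 * B - s) * y + s * y" using X1y sy by simp
    finally show ?thesis by (simp add: algebra_simps)
  qed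
  have y0: "cmod (fps_nth y 0) < 1"
    using conv_s_decaying_root[OF R, of \<sigma>] X1_0 unfolding y_def B_def s_def by simp
  have "X1 * U = X1 * (y * V)"
    using \<open>X1 * V = s * U\<close> sy by (metis mult.assoc mult.commute)
  then have UV: "U = y * V" using X1_nz by simp
  define E where "E j = y ^ j * V" for j
  define H where "H l j = fps_nth (E j) (Suc l) + fps_nth (E j) l" for l j
  have E0: "fps_nth (E j) 0 = 0" for j by (simp add: E_def V_def v0)
  have scheme: "H l (j + 1) + H l (j - 1) = of_real (2 + \<sigma>) * H l j
      - \<i> * of_real R * (fps_nth (E j) (Suc l) - fps_nth (E j) l)" if j1: "j \<ge> 1" for l j
  proof -
    obtain i where j: "j = Suc i" using j1 by (cases j) auto
    have "X1 * E (j + 1) + X1 * E (j - 1) = (X1 * (y\<^sup>2 + 1)) * E i"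
      by (simp add: j E_def power2_eq_square algebra_simps)
    also have "\<dots> = 2 * B * E j" unfolding quad by (simp add: j E_def algebra_simps)
    finally have "fps_nth (X1 * E (j + 1) + X1 * E (j - 1)) (Suc l) = fps_nth (2 * B * E j) (Suc l)"
      by simp
    moreover have "2 * B * E j = fps_const (2 * Complex (1 + \<sigma> / 2) (- R / 2)) * E j
        + fps_const (2 * Complex (1 + \<sigma> / 2) (R / 2)) * (fps_X * E j)"
      by (simp add: B_def exterior_symbol_def numeral_fps_const algebra_simps flip: fps_const_mult)
    ultimately have "H l (j + 1) + H l (j - 1)
        = 2 * Complex (1 + \<sigma> / 2) (- R / 2) * fps_nth (E j) (Suc l)
        + 2 * Complex (1 + \<sigma> / 2) (R / 2) * fps_nth (E j) l"
      by (simp add: X1_nth H_def)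
    then show ?thesis by (simp add: H_def complex_eq_iff algebra_simps)
  qed
  have energy: "Im (cnj (H l j) * (H l (j + 1) + H l (j - 1)))
      = - R * ((cmod (fps_nth (E j) (Suc l)))\<^sup>2 - (cmod (fps_nth (E j) l))\<^sup>2)" if "j \<ge> 1" for l j
    unfolding scheme[OF that] unfolding H_def cmod_power2
    by (simp add: power2_eq_square algebra_simps)
  let ?S = "\<Sum>l<n. Im (cnj (H l 1) * H l 0)"
  have le: "?S \<le> - R * (cmod (u n))\<^sup>2 - (\<Sum>l<n. Im (cnj (H l (Suc K)) * H l (Suc (Suc K))))" for K
  proof -
    have "(\<Sum>l<n. Im (cnj (H l (Suc K)) * H l (Suc (Suc K))) - Im (cnj (H l 0) * H l 1))
      = (\<Sum>l<n. \<Sum>j\<in>{1..<Suc (Suc K)}. - R * ((cmod (fps_nth (E j) (Suc l)))\<^sup>2 - (cmod (fps_nth (E j) l))\<^sup>2))"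
    proof (rule sum.cong[OF refl])
      fix l
      have "Im (cnj (H l (Suc K)) * H l (Suc (Suc K))) - Im (cnj (H l 0) * H l 1)
        = (\<Sum>j\<in>{1..<Suc (Suc K)}. Im (cnj (H l j) * (H l (j + 1) + H l (j - 1))))"
        by (rule flux_telescope[symmetric])
      also have "\<dots> = (\<Sum>j\<in>{1..<Suc (Suc K)}. - R * ((cmod (fps_nth (E j) (Suc l)))\<^sup>2 - (cmod (fps_nth (E j) l))\<^sup>2))"
        by (intro sum.cong refl energy) (simp only: atLeastLessThan_iff)
      finally show "Im (cnj (H l (Suc K)) * H l (Suc (Suc K))) - Im (cnj (H l 0) * H l 1)
        = (\<Sum>j\<in>{1..<Suc (Suc K)}. - R * ((cmod (fps_nth (E j) (Suc l)))\<^sup>2 - (cmod (fps_nth (E j) l))\<^sup>2))" .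
    qed
    also have "\<dots> = (\<Sum>j\<in>{1..<Suc (Suc K)}. \<Sum>l<n. - R * ((cmod (fps_nth (E j) (Suc l)))\<^sup>2 - (cmod (fps_nth (E j) l))\<^sup>2))"
      by (rule sum.swap)
    also have "\<dots> = (\<Sum>j\<in>{1..<Suc (Suc K)}. - R * (cmod (fps_nth (E j) n))\<^sup>2)"
    proof (rule sum.cong[OF refl])
      fix j
      have "(\<Sum>l<n. (cmod (fps_nth (E j) (Suc l)))\<^sup>2 - (cmod (fps_nth (E j) l))\<^sup>2)
          = (cmod (fps_nth (E j) n))\<^sup>2 - (cmod (fps_nth (E j) 0))\<^sup>2"
        by (rule sum_lessThan_telescope)
      then show "(\<Sum>l<n. - R * ((cmod (fps_nth (E j) (Suc l)))\<^sup>2 - (cmod (fps_nth (E j) l))\<^sup>2))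
          = - R * (cmod (fps_nth (E j) n))\<^sup>2"
        by (simp only: sum_distrib_left[symmetric] E0) simp
    qed
    also have "\<dots> = - (\<Sum>j\<in>{1..<Suc (Suc K)}. R * (cmod (fps_nth (E j) n))\<^sup>2)"
      by (simp add: sum_negf)
    also have "\<dots> \<le> - (R * (cmod (fps_nth (E 1) n))\<^sup>2)"
    proof -
      have "R * (cmod (fps_nth (E 1) n))\<^sup>2 \<le> (\<Sum>j\<in>{1..<Suc (Suc K)}. R * (cmod (fps_nth (E j) n))\<^sup>2)"
        by (rule member_le_sum) (use R in simp_all)
      then show ?thesis by linarith
    qed
    also have "E 1 = U" using UV by (simp add: E_def)
    finally have "(\<Sum>l<n. Im (cnj (H l (Suc K)) * H l (Suc (Suc K)))) - (\<Sum>l<n. Im (cnj (H l 0) * H l 1))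
       \<le> - (R * (cmod (u n))\<^sup>2)" by (simp add: sum_subtractf U_def)
    moreover have "(\<Sum>l<n. Im (cnj (H l 0) * H l 1)) = - ?S"
      unfolding sum_negf[symmetric] by (rule sum.cong) simp_all
    ultimately show ?thesis by linarith
  qed
  \<comment> \<open>The flux at the far node \<open>Suc K\<close> vanishes in the limit.\<close>
  have "(\<lambda>K. fps_nth (E K) l) \<longlonglongrightarrow> 0" for l
    unfolding E_def by (rule fps_power_coeff_tendsto_0[OF y0])
  then have "(\<lambda>K. H l K) \<longlonglongrightarrow> 0 + 0" for l
    unfolding H_def by (intro tendsto_add)
  then have H0: "(\<lambda>K. H l K) \<longlonglongrightarrow> 0" for l by simp
  have "(\<lambda>K. - R * (cmod (u n))\<^sup>2 - (\<Sum>l<n. Im (cnj (H l (Suc K)) * H l (Suc (Suc K)))))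
      \<longlonglongrightarrow> - R * (cmod (u n))\<^sup>2 - (\<Sum>l<n. Im (cnj 0 * 0))"
    by (intro tendsto_intros H0[THEN LIMSEQ_Suc] H0[THEN LIMSEQ_Suc, THEN LIMSEQ_Suc])
  then have "?S \<le> - R * (cmod (u n))\<^sup>2 - (\<Sum>l<n. Im (cnj 0 * 0))"
    using le by (intro LIMSEQ_le_const) auto
  then have S_le: "?S \<le> - R * (cmod (u n))\<^sup>2" by (simp only: complex_cnj_zero mult_zero_left zero_complex.sel sum.neutral_const diff_zero)
  have HS: "H l 1 = u (Suc l) + u l" "H l 0 = v (Suc l) + v l" for l
  proof -
    have "E 1 = U" "E 0 = V" using UV by (simp_all add: E_def)
    then show "H l 1 = u (Suc l) + u l" "H l 0 = v (Suc l) + v l"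
      by (simp_all only: H_def) (simp_all add: U_def V_def)
  qed
  show ?thesis using S_le by (simp only: HS)
qed

section \<open>The energy estimate with sources\<close>

text \<open>
  Energy estimate for the Crank-Nicolson scheme with zero initial data, sources \<open>G\<close> at the interior
  nodes, and two dissipative boundary conditions which may carry sources as well. The sources at
  the boundary nodes can be absorbed because the dissipation inequalities control the boundary
  values, so the energy is taken over all the nodes \<open>0, \<dots>, J\<close>.
\<close>
lemma discrete_energy_estimate:
  fixes w :: "nat \<Rightarrow> nat \<Rightarrow> complex" and q :: "nat \<Rightarrow> nat \<Rightarrow> real"
    and G :: "nat \<Rightarrow> nat \<Rightarrow> complex"
  defines "H \<equiv> \<lambda>l j. w (Suc l) j + w l j"
  assumes R: "R > 0" and J: "J \<ge> 1" and init: "\<And>j. j \<le> J \<Longrightarrow> w 0 j = 0"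
    and scheme: "\<And>l j. j \<in> {1..<J} \<Longrightarrow> H l (j + 1) - 2 * H l j + H l (j - 1)
        = - \<i> * of_real R * (w (Suc l) j - w l j) + of_real (q l j) * H l j + G l j"
    and left: "\<And>n. (\<Sum>l<n. Im (cnj (H l 0) * (H l 1 + G l 0))) \<le> - R * (cmod (w n 0))\<^sup>2"
    and right: "\<And>n. (\<Sum>l<n. Im (cnj (H l J) * (H l (J - 1) + G l J))) \<le> - R * (cmod (w n J))\<^sup>2"
    and G: "\<And>l j. l < N \<Longrightarrow> j \<le> J \<Longrightarrow> cmod (G l j) \<le> \<gamma>"
    and n: "n \<le> N"
  shows "R * L2_set (\<lambda>j. cmod (w n j)) {..J} \<le> 2 * real N * \<gamma> * sqrt (real J + 1)"
proof -
  define e where "e n = L2_set (\<lambda>j. cmod (w n j)) {..J}" for n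
  have e_nonneg: "e n \<ge> 0" for n unfolding e_def by simp
  have nodes: "{..J} = insert 0 (insert J {1..<J})" using J by auto
  have split_sum: "(\<Sum>j\<le>J. f j) = f 0 + f J + (\<Sum>j\<in>{1..<J}. f j)" for f :: "nat \<Rightarrow> real"
    unfolding nodes using J by simp
  have e_sq: "(e n)\<^sup>2 = (cmod (w n 0))\<^sup>2 + (cmod (w n J))\<^sup>2 + (\<Sum>j\<in>{1..<J}. (cmod (w n j))\<^sup>2)" for n
  proof -
    have "(e n)\<^sup>2 = (\<Sum>j\<le>J. (cmod (w n j))\<^sup>2)"
      unfolding e_def L2_set_def by (simp add: sum_nonneg)
    then show ?thesis by (simp only: split_sum)
  qed
  have interior: "Im (cnj (H l (J - 1)) * H l J) - Im (cnj (H l 0) * H l 1)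
      = (\<Sum>j\<in>{1..<J}. - R * ((cmod (w (Suc l) j))\<^sup>2 - (cmod (w l j))\<^sup>2))
        + (\<Sum>j\<in>{1..<J}. Im (cnj (H l j) * G l j))" for l
  proof -
    have "Im (cnj (H l (J - 1)) * H l J) - Im (cnj (H l 0) * H l 1)
        = (\<Sum>j\<in>{1..<J}. Im (cnj (H l j) * (H l (j + 1) + H l (j - 1))))"
      using flux_telescope[of "H l" "J - 1"] J by simp
    also have "\<dots> = (\<Sum>j\<in>{1..<J}. - R * ((cmod (w (Suc l) j))\<^sup>2 - (cmod (w l j))\<^sup>2)
        + Im (cnj (H l j) * G l j))"
    proof (rule sum.cong[OF refl])
      fix j assume j: "j \<in> {1..<J}"
      have neighbours: "H l (j + 1) + H l (j - 1)
          = of_real (2 + q l j) * H l j - \<i> * of_real R * (w (Suc l) j - w l j) + G l j"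
        using scheme[OF j, of l] by (simp add: algebra_simps)
      show "Im (cnj (H l j) * (H l (j + 1) + H l (j - 1)))
        = - R * ((cmod (w (Suc l) j))\<^sup>2 - (cmod (w l j))\<^sup>2) + Im (cnj (H l j) * G l j)"
        unfolding neighbours cmod_power2 by (simp add: H_def power2_eq_square algebra_simps)
    qed
    finally show ?thesis by (simp only: sum.distrib)
  qed
  have balance: "R * (e n)\<^sup>2 \<le> (\<Sum>l<n. \<Sum>j\<le>J. cmod (H l j) * cmod (G l j))" for n
  proof -
    have "(\<Sum>l<n. \<Sum>j\<in>{1..<J}. - R * ((cmod (w (Suc l) j))\<^sup>2 - (cmod (w l j))\<^sup>2))
        = (\<Sum>j\<in>{1..<J}. \<Sum>l<n. - R * ((cmod (w (Suc l) j))\<^sup>2 - (cmod (w l j))\<^sup>2))"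
      by (rule sum.swap)
    also have "\<dots> = (\<Sum>j\<in>{1..<J}. - R * (cmod (w n j))\<^sup>2)"
    proof (rule sum.cong[OF refl])
      fix j assume j: "j \<in> {1..<J}"
      have "(\<Sum>l<n. (cmod (w (Suc l) j))\<^sup>2 - (cmod (w l j))\<^sup>2) = (cmod (w n j))\<^sup>2 - (cmod (w 0 j))\<^sup>2"
        by (rule sum_lessThan_telescope)
      then show "(\<Sum>l<n. - R * ((cmod (w (Suc l) j))\<^sup>2 - (cmod (w l j))\<^sup>2)) = - R * (cmod (w n j))\<^sup>2"
        using init[of j] j by (simp only: sum_distrib_left[symmetric]) simp
    qed
    finally have "- R * (\<Sum>j\<in>{1..<J}. (cmod (w n j))\<^sup>2)
        = (\<Sum>l<n. \<Sum>j\<in>{1..<J}. - R * ((cmod (w (Suc l) j))\<^sup>2 - (cmod (w l j))\<^sup>2))"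
      by (simp only: sum_distrib_left)
    also have "\<dots> = (\<Sum>l<n. Im (cnj (H l (J - 1)) * H l J) - Im (cnj (H l 0) * H l 1)
        - (\<Sum>j\<in>{1..<J}. Im (cnj (H l j) * G l j)))"
      unfolding interior by (simp only: add_diff_cancel_right')
    finally have 1: "- R * (\<Sum>j\<in>{1..<J}. (cmod (w n j))\<^sup>2) = \<dots>" .
    have "R * (e n)\<^sup>2 = R * (cmod (w n 0))\<^sup>2 + R * (cmod (w n J))\<^sup>2 - (- R * (\<Sum>j\<in>{1..<J}. (cmod (w n j))\<^sup>2))"
      unfolding e_sq by (simp add: algebra_simps)
    also have "\<dots> \<le> - (\<Sum>l<n. Im (cnj (H l 0) * (H l 1 + G l 0)))
        - (\<Sum>l<n. Im (cnj (H l J) * (H l (J - 1) + G l J)))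
        - (- R * (\<Sum>j\<in>{1..<J}. (cmod (w n j))\<^sup>2))"
      using left[of n] right[of n] by linarith
    also have "\<dots> = (\<Sum>l<n. - Im (cnj (H l 0) * G l 0) - Im (cnj (H l J) * G l J)
        + (\<Sum>j\<in>{1..<J}. Im (cnj (H l j) * G l j)))"
      unfolding 1 sum_negf[symmetric] sum_subtractf[symmetric] sum.distrib[symmetric]
      by (intro sum.cong refl) (simp add: algebra_simps)
    also have "\<dots> \<le> (\<Sum>l<n. \<Sum>j\<le>J. cmod (H l j) * cmod (G l j))"
    proof (rule sum_mono)
      fix l
      have b: "\<bar>Im (cnj (H l j) * G l j)\<bar> \<le> cmod (H l j) * cmod (G l j)" for j
        using abs_Im_le_cmod[of "cnj (H l j) * G l j"] unfolding norm_mult complex_mod_cnj .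
      have "(\<Sum>j\<in>{1..<J}. Im (cnj (H l j) * G l j)) \<le> (\<Sum>j\<in>{1..<J}. cmod (H l j) * cmod (G l j))"
        by (rule sum_mono, rule order_trans[OF abs_ge_self b])
      then show "- Im (cnj (H l 0) * G l 0) - Im (cnj (H l J) * G l J)
        + (\<Sum>j\<in>{1..<J}. Im (cnj (H l j) * G l j)) \<le> (\<Sum>j\<le>J. cmod (H l j) * cmod (G l j))"
        unfolding split_sum using b[of 0] b[of J] by linarith
    qed
    finally show ?thesis .
  qed
  let ?g = "\<gamma> * sqrt (real J + 1)"
  have step: "(\<Sum>j\<le>J. cmod (H l j) * cmod (G l j)) \<le> (e (Suc l) + e l) * ?g" if l: "l < N" for l
  proof -
    have g: "\<gamma> \<ge> 0" using order_trans[OF norm_ge_zero G[OF l, of 0]] by simp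
    have "(\<Sum>j\<le>J. cmod (H l j) * cmod (G l j))
        \<le> (\<Sum>j\<le>J. cmod (w (Suc l) j) * \<gamma> + cmod (w l j) * \<gamma>)"
    proof (rule sum_mono)
      fix j assume "j \<in> {..J}"
      then have "cmod (H l j) * cmod (G l j) \<le> (cmod (w (Suc l) j) + cmod (w l j)) * \<gamma>"
        using G[OF l, of j] unfolding H_def by (intro mult_mono norm_triangle_ineq) auto
      then show "cmod (H l j) * cmod (G l j) \<le> cmod (w (Suc l) j) * \<gamma> + cmod (w l j) * \<gamma>"
        by (simp add: algebra_simps)
    qed
    also have "\<dots> = (\<Sum>j\<le>J. \<bar>cmod (w (Suc l) j)\<bar> * \<bar>\<gamma>\<bar>) + (\<Sum>j\<le>J. \<bar>cmod (w l j)\<bar> * \<bar>\<gamma>\<bar>)"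
      using g by (simp add: sum.distrib)
    also have "\<dots> \<le> e (Suc l) * L2_set (\<lambda>_. \<gamma>) {..J} + e l * L2_set (\<lambda>_. \<gamma>) {..J}"
      unfolding e_def by (intro add_mono L2_set_mult_ineq)
    also have "L2_set (\<lambda>_. \<gamma>) {..J} = ?g"
      using g by (simp add: L2_set_def real_sqrt_mult mult.commute add.commute)
    finally show ?thesis by (simp add: algebra_simps)
  qed
  \<comment> \<open>At a time of maximal energy the factor \<open>e\<close> in the bound can be divided out once.\<close>
  obtain p where p: "p \<le> N" "\<And>n. n \<le> N \<Longrightarrow> e n \<le> e p"
  proof -
    have "Max (e ` {..N}) \<in> e ` {..N}" by (rule Max_in) auto
    then obtain p where "p \<le> N" "Max (e ` {..N}) = e p" by (meson atMost_iff imageE)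
    moreover have "e n \<le> Max (e ` {..N})" if "n \<le> N" for n
      using that by (intro Max_ge) auto
    ultimately show ?thesis using that[of p] by simp
  qed
  have "R * e p \<le> 2 * real N * ?g"
  proof (cases "N = 0 \<or> e p = 0")
    case True
    then have "e p = 0" using p init unfolding e_def by (auto simp: L2_set_eq_0_iff)
    moreover have "2 * real N * ?g \<ge> 0"
    proof (cases "N = 0")
      case False
      then show ?thesis using order_trans[OF norm_ge_zero G[of 0 0]] by simp
    qed simp
    ultimately show ?thesis by simp
  next
    case False
    then have ep: "e p > 0" using e_nonneg[of p] by simp
    have g: "?g \<ge> 0" using False order_trans[OF norm_ge_zero G[of 0 0]] by simp
    have "R * (e p)\<^sup>2 \<le> (\<Sum>l<p. (e (Suc l) + e l) * ?g)"
      using p(1) by (intro order_trans[OF balance] sum_mono step) auto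
    also have "\<dots> \<le> (\<Sum>l<p. (e p + e p) * ?g)"
      using p by (intro sum_mono mult_right_mono add_mono g) auto
    also have "\<dots> = real p * (2 * e p * ?g)" by simp
    also have "\<dots> \<le> real N * (2 * e p * ?g)"
      using p(1) ep by (intro mult_right_mono mult_nonneg_nonneg[OF _ g]) simp_all
    finally have "(R * e p) * e p \<le> (2 * real N * ?g) * e p"
      by (simp add: power2_eq_square algebra_simps)
    then show ?thesis using ep by simp
  qed
  moreover have "R * e n \<le> R * e p" using p(2)[OF n] R by simp
  ultimately show ?thesis unfolding e_def by (simp add: mult.assoc)
qed

section \<open>Bounds for the stationary state\<close>

text \<open>
  A wave with unit amplitude comes in at node 0 through a transparent boundary condition, and the
  flux through the other end is not negative. Then the reflection coefficient has modulus at most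
  one, because the discrete Wronskian \<open>Im (cnj (\<phi> j) * \<phi> (Suc j))\<close> does not depend on \<open>j\<close>. This
  bounds the data at node 0, and a discrete Gronwall argument bounds \<open>\<phi>\<close> and its difference
  quotient.
\<close>
lemma scattering_bound:
  fixes \<phi> :: "nat \<Rightarrow> complex" and v :: "nat \<Rightarrow> real"
  assumes J: "J \<ge> 1" and dx: "dx > 0" "real J * dx = L"
    and rec: "\<And>j. j \<in> {1..<J} \<Longrightarrow> \<phi> (j + 1) - 2 * \<phi> j + \<phi> (j - 1) = of_real (v j) * \<phi> j"
    and v: "\<And>j. j \<in> {1..<J} \<Longrightarrow> \<bar>v j\<bar> \<le> V * dx\<^sup>2" and V: "V \<ge> 0"
    and a: "cmod a = 1" "Im a > 0" "cmod (a - 1) \<le> \<kappa> * dx"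
    and bc: "inverse a * \<phi> 0 - \<phi> 1 = inverse a - a"
    and flux: "Im (cnj (\<phi> (J - 1)) * \<phi> J) \<ge> 0"
  defines "K \<equiv> exp ((1 + V) * L) * (2 + 2 * \<kappa>)"
  shows "j \<le> J \<Longrightarrow> cmod (\<phi> j) \<le> K"
    and "j < J \<Longrightarrow> cmod (\<phi> (Suc j) - \<phi> j) \<le> K * dx"
proof -
  have inv_a: "inverse a = cnj a"
    using a(1) by (simp add: inverse_complex_def cmod_def complex_eq_iff)
  have flux_const: "Im (cnj (\<phi> j) * \<phi> (Suc j)) = Im (cnj (\<phi> 0) * \<phi> 1)" if "j < J" for j
    using that
  proof (induction j)
    case (Suc j)
    have next_val: "\<phi> (Suc (Suc j)) = of_real (2 + v (Suc j)) * \<phi> (Suc j) - \<phi> j"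
      using rec[of "Suc j"] Suc.prems by (simp add: algebra_simps)
    have "Im (cnj (\<phi> (Suc j)) * \<phi> (Suc (Suc j))) = Im (cnj (\<phi> j) * \<phi> (Suc j))"
      unfolding next_val by (simp add: algebra_simps)
    then show ?case using Suc by simp
  qed simp
  \<comment> \<open>The reflection coefficient: \<open>\<phi> j = a ^ j + r * cnj a ^ j\<close> for \<open>j = 0, 1\<close>.\<close>
  define r where "r = \<phi> 0 - 1"
  have ph0: "\<phi> 0 = 1 + r" by (simp add: r_def)
  have ph1: "\<phi> 1 = a + r * cnj a"
    using bc unfolding ph0 inv_a by (simp add: algebra_simps)
  have a_sq: "(Re a)\<^sup>2 + (Im a)\<^sup>2 = 1" using a(1) cmod_power2[of a] by simp
  have "0 \<le> Im (cnj (\<phi> 0) * \<phi> 1)"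
    using flux flux_const[of "J - 1"] J by simp
  also have "\<dots> = Im a * (1 - (cmod r)\<^sup>2)"
    unfolding ph0 ph1 cmod_power2 by (simp add: power2_eq_square algebra_simps)
  finally have "(cmod r)\<^sup>2 \<le> 1" using a(2) by (simp add: zero_le_mult_iff)
  then have r: "cmod r \<le> 1" by (simp add: abs_square_le_1)
  have "cmod (\<phi> 0) \<le> 2" unfolding ph0 using norm_triangle_ineq[of 1 r] r by simp
  moreover have "cmod (\<phi> 1 - \<phi> 0) / dx \<le> 2 * \<kappa>"
  proof -
    have "\<phi> 1 - \<phi> 0 = (a - 1) + r * cnj (a - 1)" unfolding ph0 ph1 by (simp add: algebra_simps)
    then have "cmod (\<phi> 1 - \<phi> 0) \<le> cmod (a - 1) + cmod r * cmod (a - 1)"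
      by (metis complex_mod_cnj norm_mult norm_triangle_ineq)
    also have "\<dots> \<le> cmod (a - 1) + 1 * cmod (a - 1)"
      using r by (intro add_left_mono mult_right_mono) auto
    also have "\<dots> \<le> 2 * \<kappa> * dx" using a(3) by simp
    finally show ?thesis using dx by (simp add: field_simps)
  qed
  ultimately have start: "cmod (\<phi> 0) + cmod (\<phi> 1 - \<phi> 0) / dx \<le> 2 + 2 * \<kappa>" by linarith
  let ?b = "(1 + dx) * (1 + V * dx)"
  have b1: "?b \<ge> 1" using dx V by (simp add: algebra_simps)
  have growth: "cmod (\<phi> j) + cmod (\<phi> (Suc j) - \<phi> j) / dx \<le> ?b ^ j * (2 + 2 * \<kappa>)" if "j < J" for j
    using that
  proof (induction j)
    case 0
    then show ?case using start by simp
  next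
    case (Suc j)
    define x where "x = cmod (\<phi> j)"
    define d where "d = cmod (\<phi> (Suc j) - \<phi> j) / dx"
    have x0: "x \<ge> 0" and d0: "d \<ge> 0" using dx by (simp_all add: x_def d_def)
    have 1: "cmod (\<phi> (Suc j)) \<le> x + dx * d"
      using norm_triangle_ineq[of "\<phi> j" "\<phi> (Suc j) - \<phi> j"] dx by (simp add: x_def d_def)
    have "\<phi> (Suc (Suc j)) - \<phi> (Suc j) = (\<phi> (Suc j) - \<phi> j) + of_real (v (Suc j)) * \<phi> (Suc j)"
      using rec[of "Suc j"] Suc.prems by (simp add: algebra_simps)
    then have "cmod (\<phi> (Suc (Suc j)) - \<phi> (Suc j))
        \<le> cmod (\<phi> (Suc j) - \<phi> j) + \<bar>v (Suc j)\<bar> * cmod (\<phi> (Suc j))"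
      by (metis norm_mult norm_of_real norm_triangle_ineq)
    also have "\<dots> \<le> cmod (\<phi> (Suc j) - \<phi> j) + V * dx\<^sup>2 * cmod (\<phi> (Suc j))"
      using v[of "Suc j"] Suc.prems by (intro add_left_mono mult_right_mono) auto
    finally have 2: "cmod (\<phi> (Suc (Suc j)) - \<phi> (Suc j)) / dx \<le> d + V * dx * cmod (\<phi> (Suc j))"
      using dx by (simp add: d_def field_simps power2_eq_square)
    have "cmod (\<phi> (Suc j)) + cmod (\<phi> (Suc (Suc j)) - \<phi> (Suc j)) / dx
        \<le> d + (1 + V * dx) * cmod (\<phi> (Suc j))" using 2 by (simp add: algebra_simps)
    also have "\<dots> \<le> d + (1 + V * dx) * (x + dx * d)"
      using 1 V dx by (intro add_left_mono mult_left_mono) auto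
    also have "\<dots> \<le> ?b * (x + d)"
      using x0 d0 V dx by (simp add: algebra_simps)
    also have "\<dots> \<le> ?b * (?b ^ j * (2 + 2 * \<kappa>))"
      using Suc b1 by (intro mult_left_mono) (auto simp: x_def d_def)
    finally show ?case by simp
  qed
  have \<kappa>: "2 + 2 * \<kappa> \<ge> 0"
    using start by (meson add_nonneg_nonneg divide_nonneg_nonneg norm_ge_zero dx less_imp_le order_trans)
  have "?b ^ j \<le> exp ((1 + V) * L)" if "j \<le> J" for j
  proof -
    have "?b ^ j \<le> ?b ^ J" using that b1 by (rule power_increasing)
    also have "\<dots> \<le> (exp dx * exp (V * dx)) ^ J"
      using dx V by (intro power_mono mult_mono exp_ge_add_one_self mult_nonneg_nonneg) auto
    also have "\<dots> = exp ((1 + V) * L)"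
      unfolding dx(2)[symmetric] by (simp add: algebra_simps flip: exp_add exp_of_nat_mult)
    finally show ?thesis .
  qed
  then have b_le: "?b ^ j * (2 + 2 * \<kappa>) \<le> K" if "j \<le> J" for j
    using that \<kappa> unfolding K_def by (intro mult_right_mono) auto
  show "cmod (\<phi> (Suc j) - \<phi> j) \<le> K * dx" if "j < J"
  proof -
    have "cmod (\<phi> (Suc j) - \<phi> j) / dx \<le> K"
      using growth[OF that] b_le[of j] that norm_ge_zero[of "\<phi> j"] by linarith
    then show ?thesis using dx by (simp add: field_simps)
  qed
  show "cmod (\<phi> j) \<le> K" if "j \<le> J"
  proof (cases j)
    case 0
    have "cmod (\<phi> 0) \<le> 2 + 2 * \<kappa>"
      using start dx divide_nonneg_pos[OF norm_ge_zero[of "\<phi> 1 - \<phi> 0"], of dx] by linarith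
    then show ?thesis using b_le[of 0] 0 by simp
  next
    case (Suc i)
    define x where "x = cmod (\<phi> i)"
    define d where "d = cmod (\<phi> (Suc i) - \<phi> i) / dx"
    have x0: "x \<ge> 0" and d0: "d \<ge> 0" using dx by (simp_all add: x_def d_def)
    have "cmod (\<phi> (Suc i)) \<le> x + dx * d"
      using norm_triangle_ineq[of "\<phi> i" "\<phi> (Suc i) - \<phi> i"] dx by (simp add: x_def d_def)
    also have "\<dots> \<le> ?b * (x + d)"
      using x0 d0 V dx by (simp add: algebra_simps)
    also have "\<dots> \<le> ?b * (?b ^ i * (2 + 2 * \<kappa>))"
      using growth[of i] that Suc b1 by (intro mult_left_mono) (auto simp: x_def d_def)
    also have "\<dots> \<le> K" using b_le[of j] that Suc by (simp add: mult.assoc)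
    finally show ?thesis using Suc by simp
  qed
qed

lemma alpha1_props:
  assumes k: "k \<noteq> 0" and dx: "dx > 0" "dx * \<bar>k\<bar> < 1"
  shows "cmod (alpha1 k dx) = 1" and "Im (alpha1 k dx) > 0"
    and "cmod (alpha1 k dx - 1) \<le> \<bar>k\<bar> * dx" and "alpha2 k dx = inverse (alpha1 k dx)"
proof -
  define p where "p = (dx * \<bar>k\<bar>)\<^sup>2"
  have p: "0 < p" "p < 1" using k dx by (simp_all add: p_def power_less_one_iff abs_square_less_1)
  have pos: "p - p\<^sup>2 / 4 > 0"
  proof -
    have "p * p < p * 1" using p by (intro mult_strict_left_mono)
    then show ?thesis using p by (simp add: power2_eq_square)
  qed
  have e: "dx\<^sup>2 * (k\<^sup>2 / 2) = p / 2" "dx\<^sup>2 * k\<^sup>2 - dx ^ 4 * (k ^ 4 / 4) = p - p\<^sup>2 / 4"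
    by (simp_all add: p_def power_mult_distrib flip: power_mult)
  have cs: "csqrt (of_real (p - p\<^sup>2 / 4)) = of_real (sqrt (p - p\<^sup>2 / 4))"
    using pos by (simp only: of_real_sqrt less_imp_le)
  have a1: "alpha1 k dx = Complex (1 - p / 2) (sqrt (p - p\<^sup>2 / 4))"
    unfolding alpha1_def e cs by (simp add: complex_eq_iff)
  have a2: "alpha2 k dx = cnj (alpha1 k dx)"
    unfolding a1 unfolding alpha2_def e cs by (simp add: complex_eq_iff)
  have "(cmod (alpha1 k dx))\<^sup>2 = 1"
    unfolding cmod_power2 a1 using pos by (simp add: power2_eq_square algebra_simps)
  then show c: "cmod (alpha1 k dx) = 1"
    using norm_ge_zero[of "alpha1 k dx"] unfolding power2_eq_1_iff by linarith
  show "Im (alpha1 k dx) > 0" using pos by (simp add: a1)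
  have "(cmod (alpha1 k dx - 1))\<^sup>2 = (\<bar>k\<bar> * dx)\<^sup>2"
    unfolding cmod_power2 a1 using pos by (simp add: power2_eq_square algebra_simps p_def)
  then show "cmod (alpha1 k dx - 1) \<le> \<bar>k\<bar> * dx"
    using dx by (simp add: power2_eq_iff_nonneg)
  show "alpha2 k dx = inverse (alpha1 k dx)"
    unfolding a2 using c by (simp add: inverse_complex_def cmod_def complex_eq_iff)
qed

lemma Im_of_real_csqrt:
  "Im (of_real p + \<i> * csqrt (of_real x)) \<ge> 0" "Im (of_real p - \<i> * csqrt (of_real x)) \<le> 0"
proof -
  have Re: "Re (csqrt (of_real x)) \<ge> 0" using csqrt_principal[of "of_real x"] by auto
  have "Im (of_real p + \<i> * z) = Re z" "Im (of_real p - \<i> * z) = - Re z" for z by simp_all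
  then show "Im (of_real p + \<i> * csqrt (of_real x)) \<ge> 0" "Im (of_real p - \<i> * csqrt (of_real x)) \<le> 0"
    using Re by (simp_all only: neg_le_0_iff_le)
qed

lemma stationary_coefficient_bound:
  fixes c d q M E :: real
  assumes c: "c \<ge> 0" and q: "\<bar>q\<bar> \<le> \<bar>M\<bar>"
  shows "\<bar>d\<^sup>2 * (c * (q - E))\<bar> \<le> c * (\<bar>M\<bar> + \<bar>E\<bar>) * d\<^sup>2"
proof -
  have "\<bar>q - E\<bar> \<le> \<bar>M\<bar> + \<bar>E\<bar>" using q by linarith
  then have "d\<^sup>2 * (c * \<bar>q - E\<bar>) \<le> d\<^sup>2 * (c * (\<bar>M\<bar> + \<bar>E\<bar>))"
    using c by (intro mult_left_mono) auto
  moreover have "\<bar>d\<^sup>2 * (c * (q - E))\<bar> = d\<^sup>2 * (c * \<bar>q - E\<bar>)"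
    unfolding abs_mult[of "d\<^sup>2"] abs_mult[of c]
    by (simp only: abs_of_nonneg[OF c] abs_of_nonneg[OF zero_le_power2])
  ultimately show ?thesis by (simp only: mult_ac)
qed

lemma stationary_recurrence:
  assumes "stationary_solution hbar m QIL k QI J dx \<Phi>" "dx > 0" "j \<in> {1..<J}"
  shows "\<Phi> (j + 1) - 2 * \<Phi> j + \<Phi> (j - 1)
    = of_real (dx\<^sup>2 * (2 * m / hbar\<^sup>2 * (QI (real j * dx) - energy hbar m QIL k))) * \<Phi> j"
proof -
  have "(\<Phi> (j + 1) - 2 * \<Phi> j + \<Phi> (j - 1)) / of_real (dx\<^sup>2)
      = of_real (2 * m / hbar\<^sup>2 * (QI (real j * dx) - energy hbar m QIL k)) * \<Phi> j"
    using assms(1,3) unfolding stationary_solution_def by blast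
  moreover have "complex_of_real (dx\<^sup>2) \<noteq> 0" using assms(2) by simp
  ultimately have "\<Phi> (j + 1) - 2 * \<Phi> j + \<Phi> (j - 1) = of_real (dx\<^sup>2) *
      (of_real (2 * m / hbar\<^sup>2 * (QI (real j * dx) - energy hbar m QIL k)) * \<Phi> j)"
    by (metis nonzero_mult_div_cancel_left times_divide_eq_right)
  then show ?thesis by (simp only: of_real_mult mult.assoc)
qed

text \<open>
  In both cases the sign of the flux through the outgoing end is that of the imaginary part of
  \<open>beta\<close>, whether the outgoing wave propagates or is evanescent. Hence the bounds hold uniformly
  in the grid, although the transmission may be total or zero.
\<close>
lemma stationary_bounds:
  fixes hbar m QIL k M L dx :: real and \<Phi> :: "nat \<Rightarrow> complex"
  defines "V \<equiv> 2 * m / hbar\<^sup>2 * (\<bar>M\<bar> + \<bar>energy hbar m QIL k\<bar>)"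
  defines "K \<equiv> exp ((1 + V) * L) * (2 + 2 * \<bar>k\<bar>)"
  assumes "hbar > 0" "m > 0" and k: "k \<noteq> 0" and J: "J \<ge> 1"
    and dx: "dx > 0" "real J * dx = L" "dx * \<bar>k\<bar> < 1"
    and QI: "\<And>j. j \<in> {1..<J} \<Longrightarrow> \<bar>QI (real j * dx)\<bar> \<le> \<bar>M\<bar>"
    and sol: "stationary_solution hbar m QIL k QI J dx \<Phi>"
  shows "j \<le> J \<Longrightarrow> cmod (\<Phi> j) \<le> K"
    and "j < J \<Longrightarrow> cmod (\<Phi> (Suc j) - \<Phi> j) \<le> K * dx"
proof -
  define v where "v j = dx\<^sup>2 * (2 * m / hbar\<^sup>2 * (QI (real j * dx) - energy hbar m QIL k))" for j
  let ?a = "alpha1 k dx"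
  note alpha = alpha1_props[OF k dx(1,3)]
  have c0: "2 * m / hbar\<^sup>2 \<ge> 0" using assms by simp
  have V: "V \<ge> 0" unfolding V_def using c0 by (intro mult_nonneg_nonneg) auto
  have v: "\<bar>v j\<bar> \<le> V * dx\<^sup>2" if "j \<in> {1..<J}" for j
    unfolding v_def V_def by (rule stationary_coefficient_bound[OF c0 QI[OF that]])
  have rec: "\<Phi> (j + 1) - 2 * \<Phi> j + \<Phi> (j - 1) = of_real (v j) * \<Phi> j" if "j \<in> {1..<J}" for j
    unfolding v_def by (rule stationary_recurrence[OF sol dx(1) that])
  have "(j \<le> J \<longrightarrow> cmod (\<Phi> j) \<le> K) \<and> (j < J \<longrightarrow> cmod (\<Phi> (Suc j) - \<Phi> j) \<le> K * dx)" for j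
  proof (cases "k > 0")
    case True
    let ?b = "beta1_right hbar m QIL k dx"
    have bc: "inverse ?a * \<Phi> 0 - \<Phi> 1 = inverse ?a - ?a" "- \<Phi> (J - 1) + inverse ?b * \<Phi> J = 0"
      using sol True unfolding stationary_solution_def stationary_bc_def by auto
    have "Im ?b \<ge> 0" unfolding beta1_right_def by (rule Im_of_real_csqrt)
    have \<Phi>J: "\<Phi> (J - 1) = inverse ?b * \<Phi> J" using bc(2) by (simp add: add_eq_0_iff)
    have "cnj (\<Phi> (J - 1)) * \<Phi> J = cnj (inverse ?b) * of_real ((cmod (\<Phi> J))\<^sup>2)"
      unfolding \<Phi>J complex_norm_square by (simp add: mult_ac)
    then have "Im (cnj (\<Phi> (J - 1)) * \<Phi> J) = (cmod (\<Phi> J))\<^sup>2 * (Im ?b / (cmod ?b)\<^sup>2)"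
      by (simp add: cmod_power2)
    also have "\<dots> \<ge> 0" using \<open>Im ?b \<ge> 0\<close> by (intro mult_nonneg_nonneg) auto
    finally have flux: "Im (cnj (\<Phi> (J - 1)) * \<Phi> J) \<ge> 0" .
    show ?thesis
      using scattering_bound[OF J dx(1,2) rec v V alpha(1-3) bc(1) flux] unfolding K_def by blast
  next
    case False
    then have neg: "\<not> k > 0" .
    let ?b = "beta2_left hbar m QIL k dx"
    have bc: "?b * \<Phi> 0 - \<Phi> 1 = 0" "- \<Phi> (J - 1) + alpha2 k dx * \<Phi> J
          = alpha2 k dx ^ J * (alpha2 k dx - inverse (alpha2 k dx))"
      using sol neg unfolding stationary_solution_def stationary_bc_def by auto
    have "Im ?b \<le> 0" unfolding beta2_left_def by (rule Im_of_real_csqrt)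
    \<comment> \<open>For \<open>k < 0\<close> the wave comes in from the right; reflect the grid and normalize the phase.\<close>
    define \<phi> where "\<phi> j = ?a ^ J * \<Phi> (J - j)" for j
    have a_nz: "?a \<noteq> 0" using alpha(1) by auto
    have aJ: "?a ^ J * inverse ?a ^ J = 1" using a_nz by (simp flip: power_mult_distrib)
    have norm_aJ: "cmod (?a ^ J) = 1" using alpha(1) by (simp add: norm_power)
    have rec': "\<phi> (j + 1) - 2 * \<phi> j + \<phi> (j - 1) = of_real (v (J - j)) * \<phi> j" if j: "j \<in> {1..<J}" for j
    proof -
      have idx: "J - (j + 1) = (J - j) - 1" "J - (j - 1) = (J - j) + 1" "J - j \<in> {1..<J}" using j by auto
      have "\<phi> (j + 1) - 2 * \<phi> j + \<phi> (j - 1)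
          = ?a ^ J * (\<Phi> ((J - j) + 1) - 2 * \<Phi> (J - j) + \<Phi> ((J - j) - 1))"
        unfolding \<phi>_def idx by (simp add: algebra_simps)
      then show ?thesis unfolding rec[OF idx(3)] by (simp add: \<phi>_def)
    qed
    have v': "\<bar>v (J - j)\<bar> \<le> V * dx\<^sup>2" if "j \<in> {1..<J}" for j
      using that by (intro v) auto
    have bc': "inverse ?a * \<phi> 0 - \<phi> 1 = inverse ?a - ?a"
    proof -
      have "inverse ?a * \<phi> 0 - \<phi> 1 = ?a ^ J * (- \<Phi> (J - 1) + inverse ?a * \<Phi> J)"
        unfolding \<phi>_def by (simp add: algebra_simps)
      also have "\<dots> = (?a ^ J * inverse ?a ^ J) * (inverse ?a - ?a)"
        using bc(2) unfolding alpha(4) by simp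
      finally show ?thesis unfolding aJ by simp
    qed
    have flux': "Im (cnj (\<phi> (J - 1)) * \<phi> J) \<ge> 0"
    proof -
      have idx: "J - (J - 1) = 1" using J by simp
      have "cnj (\<phi> (J - 1)) * \<phi> J = (cnj (?a ^ J) * ?a ^ J) * (cnj (\<Phi> 1) * \<Phi> 0)"
        unfolding \<phi>_def idx by simp
      also have "cnj (?a ^ J) * ?a ^ J = 1"
        using norm_aJ complex_norm_square[of "?a ^ J"] by (simp add: mult.commute)
      also have "1 * (cnj (\<Phi> 1) * \<Phi> 0) = cnj ?b * of_real ((cmod (\<Phi> 0))\<^sup>2)"
      proof -
        have "\<Phi> 1 = ?b * \<Phi> 0" using bc(1) by simp
        then show ?thesis unfolding complex_norm_square by (simp only: complex_cnj_mult mult_ac mult_1)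
      qed
      finally have "Im (cnj (\<phi> (J - 1)) * \<phi> J) = (- Im ?b) * (cmod (\<Phi> 0))\<^sup>2" by simp
      also have "\<dots> \<ge> 0" using \<open>Im ?b \<le> 0\<close> by (intro mult_nonneg_nonneg) auto
      finally show ?thesis .
    qed
    note bounds = scattering_bound[OF J dx(1,2) rec' v' V alpha(1-3) bc' flux', folded K_def]
    show ?thesis
    proof (intro conjI impI)
      assume "j \<le> J"
      then have "\<phi> (J - j) = ?a ^ J * \<Phi> j" unfolding \<phi>_def by simp
      then have "cmod (\<Phi> j) = cmod (\<phi> (J - j))" using norm_aJ by (simp add: norm_mult)
      then show "cmod (\<Phi> j) \<le> K" using bounds(1)[of "J - j"] by simp
    next
      assume j: "j < J"
      then have idx: "J - Suc (J - Suc j) = j" "J - (J - Suc j) = Suc j" by auto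
      have "\<phi> (Suc (J - Suc j)) - \<phi> (J - Suc j) = - (?a ^ J * (\<Phi> (Suc j) - \<Phi> j))"
        unfolding \<phi>_def idx by (simp add: algebra_simps)
      then have "cmod (\<Phi> (Suc j) - \<Phi> j) = cmod (\<phi> (Suc (J - Suc j)) - \<phi> (J - Suc j))"
        using norm_aJ by (simp only: norm_minus_cancel norm_mult)
      then show "cmod (\<Phi> (Suc j) - \<Phi> j) \<le> K * dx" using bounds(2)[of "J - Suc j"] j by simp
    qed
  qed
  then show "j \<le> J \<Longrightarrow> cmod (\<Phi> j) \<le> K" and "j < J \<Longrightarrow> cmod (\<Phi> (Suc j) - \<Phi> j) \<le> K * dx"
    by blast+
qed

section \<open>The lift of the boundary data\<close>

text \<open>
  The factor in time of a plane wave of angular frequency \<open>\<omega>\<close>, at the time step \<open>l\<close>.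
\<close>
definition wave :: "real \<Rightarrow> real \<Rightarrow> nat \<Rightarrow> complex" where
  "wave \<omega> dt l = exp (- \<i> * of_real (\<omega> * (real l * dt)))"

lemma norm_wave [simp]: "cmod (wave \<omega> dt l) = 1"
  by (simp add: wave_def)

text \<open>
  The angular frequencies are chosen so that the time oscillation solves the Crank-Nicolson
  discretization of \<open>i \<hbar> e' = E e\<close> exactly; here \<open>t = dt * E / (2 * hbar)\<close>.
\<close>
lemma wave_crank_nicolson:
  assumes "dt > 0"
  shows "\<i> * (wave (2 / dt * arctan t) dt (Suc l) - wave (2 / dt * arctan t) dt l)
    = of_real t * (wave (2 / dt * arctan t) dt (Suc l) + wave (2 / dt * arctan t) dt l)"
proof -
  let ?\<theta> = "arctan t"
  define c where "c = cis (- (?\<theta> * (2 * real l + 1)))"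
  have w: "wave (2 / dt * ?\<theta>) dt n = cis (- (2 * ?\<theta> * real n))" for n
    using assms by (simp add: wave_def cis_conv_exp mult.assoc)
  have 1: "wave (2 / dt * ?\<theta>) dt (Suc l) = c * cis (- ?\<theta>)"
    unfolding w c_def cis_mult by (simp add: algebra_simps)
  have 2: "wave (2 / dt * ?\<theta>) dt l = c * cis ?\<theta>"
    unfolding w c_def cis_mult by (simp add: algebra_simps)
  have "sin ?\<theta> = t * cos ?\<theta>"
    using tan_arctan[of t] cos_arctan_not_zero[of t] by (simp add: tan_def field_simps)
  then have "\<i> * (cis (- ?\<theta>) - cis ?\<theta>) = of_real t * (cis (- ?\<theta>) + cis ?\<theta>)"
    by (simp add: complex_eq_iff)
  then have "c * (\<i> * (cis (- ?\<theta>) - cis ?\<theta>)) = c * (of_real t * (cis (- ?\<theta>) + cis ?\<theta>))" by simp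
  then show ?thesis unfolding 1 2 by (simp add: algebra_simps)
qed

text \<open>
  A transition from 0 to 1 with vanishing derivative at both ends. On the grid it differs from its
  end values only by \<open>O(h\<^sup>2)\<close> at the nodes next to the boundary. It therefore needs no node where
  it is constant, and grids with few nodes are no exception.
\<close>
definition smoothstep :: "real \<Rightarrow> real" where
  "smoothstep s = 3 * s\<^sup>2 - 2 * s ^ 3"

lemma smoothstep_bounds:
  assumes "0 \<le> s" "s \<le> 1"
  shows "0 \<le> smoothstep s" and "smoothstep s \<le> 1"
proof -
  have "smoothstep s = s\<^sup>2 * (3 - 2 * s)" "1 - smoothstep s = (1 - s)\<^sup>2 * (1 + 2 * s)"
    by (simp_all add: smoothstep_def power2_eq_square power3_eq_cube algebra_simps)
  moreover have "s\<^sup>2 * (3 - 2 * s) \<ge> 0" "(1 - s)\<^sup>2 * (1 + 2 * s) \<ge> 0"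
    using assms by (auto intro!: mult_nonneg_nonneg)
  ultimately show "0 \<le> smoothstep s" and "smoothstep s \<le> 1" by linarith+
qed

lemma smoothstep_diff:
  assumes "0 \<le> s" "0 \<le> h" "s + h \<le> 1"
  shows "\<bar>smoothstep (s + h) - smoothstep s\<bar> \<le> 6 * h"
proof -
  let ?f = "3 * (2 * s + h) - 2 * ((s + h)\<^sup>2 + (s + h) * s + s\<^sup>2)"
  have "smoothstep (s + h) - smoothstep s = h * ?f"
    by (simp add: smoothstep_def power2_eq_square power3_eq_cube algebra_simps)
  moreover have "\<bar>?f\<bar> \<le> 6"
  proof -
    have "(s + h)\<^sup>2 \<le> 1" "s\<^sup>2 \<le> 1" "(s + h) * s \<le> 1"
      using assms by (simp_all add: power_le_one mult_le_one)
    moreover have "(s + h)\<^sup>2 \<ge> 0" "s\<^sup>2 \<ge> 0" "(s + h) * s \<ge> 0" using assms by simp_all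
    moreover have "\<bar>3 * (2 * s + h) - 2 * (a + b + c)\<bar> \<le> 6"
      if "a \<le> 1" "c \<le> 1" "b \<le> 1" "0 \<le> a" "0 \<le> c" "0 \<le> b" for a b c :: real
      using that assms by (simp add: abs_le_iff)
    ultimately show ?thesis by blast
  qed
  ultimately show ?thesis
    using assms(2) mult_left_mono[of "\<bar>?f\<bar>" 6 h] by (simp add: abs_mult mult.commute)
qed

lemma smoothstep_second_diff:
  assumes "0 \<le> s" "s \<le> 1"
  shows "\<bar>smoothstep (s + h) - 2 * smoothstep s + smoothstep (s - h)\<bar> \<le> 6 * h\<^sup>2"
proof -
  have "smoothstep (s + h) - 2 * smoothstep s + smoothstep (s - h) = (6 * h\<^sup>2) * (1 - 2 * s)"
    by (simp add: smoothstep_def power2_eq_square power3_eq_cube algebra_simps)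
  moreover have "\<bar>1 - 2 * s\<bar> \<le> 1" using assms by linarith
  ultimately show ?thesis
    using mult_left_mono[of "\<bar>1 - 2 * s\<bar>" 1 "6 * h\<^sup>2"] by (simp add: abs_mult)
qed

text \<open>
  The scheme multiplied by \<open>- 4 m dx\<^sup>2 / hbar\<^sup>2\<close>, in terms of sums over two consecutive time
  levels.
\<close>
lemma crank_nicolson_scaled:
  assumes "crank_nicolson hbar m Qh J dx dt \<Psi>" and pos: "hbar > 0" "m > 0" "dx > 0" "dt > 0"
    and j: "j \<in> {1..<J}"
  defines "H \<equiv> \<lambda>l j. \<Psi> (Suc l) j + \<Psi> l j"
  shows "H l (j + 1) - 2 * H l j + H l (j - 1)
     = - \<i> * of_real (conv_R hbar m dx dt) * (\<Psi> (Suc l) j - \<Psi> l j)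
       + of_real (2 * m * dx\<^sup>2 / hbar\<^sup>2 * Qh l j) * H l j"
proof -
  define D where "D = H l (j + 1) - 2 * H l j + H l (j - 1)"
  define d where "d = \<Psi> (Suc l) j - \<Psi> l j"
  have "\<i> * of_real hbar * (d / of_real dt)
     = - of_real (hbar\<^sup>2 / (2 * m)) * (((\<Psi> l (j + 1) + \<Psi> (l + 1) (j + 1)) / 2
        - 2 * ((\<Psi> l j + \<Psi> (l + 1) j) / 2) + (\<Psi> l (j - 1) + \<Psi> (l + 1) (j - 1)) / 2) / of_real (dx\<^sup>2))
      + of_real (Qh l j) * ((\<Psi> l j + \<Psi> (l + 1) j) / 2)"
    using assms(1) j unfolding crank_nicolson_def Let_def d_def by simp
  also have "(\<Psi> l (j + 1) + \<Psi> (l + 1) (j + 1)) / 2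
        - 2 * ((\<Psi> l j + \<Psi> (l + 1) j) / 2) + (\<Psi> l (j - 1) + \<Psi> (l + 1) (j - 1)) / 2 = D / 2"
    by (simp add: D_def H_def field_simps)
  also have "\<Psi> l j + \<Psi> (l + 1) j = H l j" by (simp add: H_def)
  finally have eq: "\<i> * of_real hbar * (d / of_real dt)
     = - of_real (hbar\<^sup>2 / (2 * m)) * (D / 2 / of_real (dx\<^sup>2)) + of_real (Qh l j) * (H l j / 2)" .
  have nz: "complex_of_real hbar \<noteq> 0" "complex_of_real m \<noteq> 0" "complex_of_real dx \<noteq> 0" "complex_of_real dt \<noteq> 0"
    using pos by auto
  have "D = - \<i> * of_real (conv_R hbar m dx dt) * d + of_real (2 * m * dx\<^sup>2 / hbar\<^sup>2 * Qh l j) * H l j"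
    using eq nz unfolding conv_R_def by (simp add: field_simps power2_eq_square)
  then show ?thesis unfolding D_def d_def .
qed

lemma wave_scaled:
  fixes hbar m dx dt E :: real
  assumes "dt > 0" "hbar > 0" "m > 0"
  defines "e \<equiv> wave (2 / dt * arctan (dt * E / (2 * hbar))) dt"
  shows "\<i> * of_real (conv_R hbar m dx dt) * (e (Suc l) - e l)
    = of_real (2 * m * dx\<^sup>2 / hbar\<^sup>2 * E) * (e (Suc l) + e l)"
proof -
  have "\<i> * of_real (conv_R hbar m dx dt) * (e (Suc l) - e l)
      = of_real (conv_R hbar m dx dt) * (\<i> * (e (Suc l) - e l))" by (simp add: algebra_simps)
  also have "\<dots> = of_real (conv_R hbar m dx dt) * (of_real (dt * E / (2 * hbar)) * (e (Suc l) + e l))"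
    unfolding e_def wave_crank_nicolson[OF assms(1)] ..
  also have "\<dots> = of_real (conv_R hbar m dx dt * (dt * E / (2 * hbar))) * (e (Suc l) + e l)"
    by (simp only: of_real_mult mult.assoc)
  also have "conv_R hbar m dx dt * (dt * E / (2 * hbar)) = 2 * m * dx\<^sup>2 / hbar\<^sup>2 * E"
    using assms unfolding conv_R_def by (simp add: field_simps power2_eq_square)
  finally show ?thesis .
qed

text \<open>
  The residual at an interior node of the lift \<open>\<Phi>\<^sub>j (e\<^sub>0 + \<tau>\<^sub>j (e\<^sub>L - e\<^sub>0))\<close> in the scaled scheme.
  Here \<open>a, b, c\<close> are values of \<open>\<Phi>\<close> and \<open>x, y, z\<close> values of the transition \<open>\<tau>\<close> at three
  neighbouring nodes, \<open>h0\<close> and \<open>hL\<close> are sums of \<open>e\<^sub>0\<close> and \<open>e\<^sub>L\<close> over two time levels, and every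
  term carries \<open>d\<^sup>2\<close>, from a coefficient, a second difference or a product of first differences.
\<close>
lemma lift_residual_bound:
  fixes a b c h0 hL :: complex and x y z :: real
  assumes y: "0 \<le> y" "y \<le> 1" and h: "cmod h0 \<le> 2" "cmod hL \<le> 2"
    and b: "cmod b \<le> K" and diffs: "cmod (c - b) \<le> K * d" "cmod (b - a) \<le> K * d"
    and second: "c - 2 * b + a = of_real v * b" "\<bar>v\<bar> \<le> V * d\<^sup>2"
    and chi: "\<bar>z - y\<bar> \<le> 6 * (d / L)" "\<bar>y - x\<bar> \<le> 6 * (d / L)" "\<bar>z - 2 * y + x\<bar> \<le> 6 * (d / L)\<^sup>2"
    and rates: "\<bar>v0\<bar> \<le> W * d\<^sup>2" "\<bar>vL\<bar> \<le> W * d\<^sup>2" "\<bar>q\<bar> \<le> U * d\<^sup>2"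
    and pos: "d > 0" "L > 0" "K \<ge> 0"
  defines "\<eta> \<equiv> \<lambda>t. h0 + of_real t * (hL - h0)"
  shows "cmod (of_real q * b * \<eta> y - (c * \<eta> z - 2 * (b * \<eta> y) + a * \<eta> x)
       - b * (of_real v0 * h0 + of_real y * (of_real vL * hL - of_real v0 * h0)))
    \<le> d\<^sup>2 * (K * (6 * V + 48 / L + 24 / L\<^sup>2 + 2 * W + 2 * U))"
proof -
  have convex: "cmod (p + of_real y * (r - p)) \<le> B" if "cmod p \<le> B" "cmod r \<le> B" for p r B
  proof -
    have "p + of_real y * (r - p) = of_real (1 - y) * p + of_real y * r" by (simp add: algebra_simps)
    then have "cmod (p + of_real y * (r - p)) \<le> (1 - y) * cmod p + y * cmod r"
      using y norm_triangle_ineq[of "of_real (1 - y) * p" "of_real y * r"]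
      by (simp add: norm_mult del: of_real_diff)
    also have "\<dots> \<le> (1 - y) * B + y * B" using that y by (intro add_mono mult_left_mono) auto
    finally show ?thesis by (simp add: algebra_simps)
  qed
  define S where "S = of_real z * c - 2 * of_real y * b + of_real x * a"
  \<comment> \<open>Discrete product rule for the second difference.\<close>
  have S: "S = of_real (y * v) * b + of_real (z - y) * (c - b) + of_real (y - x) * (b - a)
      + of_real (z - 2 * y + x) * b"
  proof -
    have "S = of_real y * (c - 2 * b + a) + of_real (z - y) * (c - b) + of_real (y - x) * (b - a)
      + of_real (z - 2 * y + x) * b"
      unfolding S_def by (simp add: algebra_simps)
    then show ?thesis unfolding second(1) by (simp add: mult.assoc)
  qed
  have Vd: "0 \<le> V * d\<^sup>2" using second(2) by linarith
  have vb: "\<bar>v\<bar> * cmod b \<le> V * d\<^sup>2 * K" using second(2) b Vd by (intro mult_mono) auto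
  have dL: "0 \<le> 6 * (d / L)" using pos by simp
  have "cmod S \<le> cmod (of_real (y * v) * b) + cmod (of_real (z - y) * (c - b))
      + cmod (of_real (y - x) * (b - a)) + cmod (of_real (z - 2 * y + x) * b)"
    unfolding S by (intro order_trans[OF norm_triangle_ineq] add_right_mono order_refl)
  also have "\<dots> = y * (\<bar>v\<bar> * cmod b) + \<bar>z - y\<bar> * cmod (c - b) + \<bar>y - x\<bar> * cmod (b - a)
      + \<bar>z - 2 * y + x\<bar> * cmod b"
    using y unfolding norm_mult norm_of_real by (simp add: abs_mult)
  also have "\<dots> \<le> 1 * (V * d\<^sup>2 * K) + 6 * (d / L) * (K * d) + 6 * (d / L) * (K * d) + 6 * (d / L)\<^sup>2 * K"
    using y vb chi diffs b dL pos mult_nonneg_nonneg[OF Vd pos(3)] by (intro add_mono mult_mono[of y] vb mult_mono) auto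
  also have "\<dots> = d\<^sup>2 * (K * (V + 12 / L + 6 / L\<^sup>2))"
    using pos by (simp add: field_simps power2_eq_square)
  finally have S_le: "cmod S \<le> d\<^sup>2 * (K * (V + 12 / L + 6 / L\<^sup>2))" .
  have hd: "cmod (hL - h0) \<le> 4" using norm_triangle_ineq4[of hL h0] h by linarith
  have 1: "cmod (of_real q * b * \<eta> y) \<le> U * d\<^sup>2 * K * 2"
    unfolding norm_mult norm_of_real \<eta>_def
    using rates(3) b pos convex[OF h] order_trans[OF abs_ge_zero rates(3)]
    by (intro mult_mono mult_nonneg_nonneg[of "U * d\<^sup>2"]) auto
  have eq2: "c * \<eta> z - 2 * (b * \<eta> y) + a * \<eta> x = h0 * (of_real v * b) + (hL - h0) * S"
    unfolding second(1)[symmetric] \<eta>_def S_def by (simp add: algebra_simps)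
  have "cmod (c * \<eta> z - 2 * (b * \<eta> y) + a * \<eta> x)
      \<le> cmod h0 * (\<bar>v\<bar> * cmod b) + cmod (hL - h0) * cmod S"
    unfolding eq2 using norm_triangle_ineq[of "h0 * (of_real v * b)" "(hL - h0) * S"]
    by (simp only: norm_mult norm_of_real)
  also have "\<dots> \<le> 2 * (V * d\<^sup>2 * K) + 4 * (d\<^sup>2 * (K * (V + 12 / L + 6 / L\<^sup>2)))"
    using h hd by (intro add_mono mult_mono[OF _ vb] mult_mono[OF _ S_le]) auto
  finally have 2: "cmod (c * \<eta> z - 2 * (b * \<eta> y) + a * \<eta> x) \<le> \<dots>" .
  have "cmod (of_real v0 * h0) \<le> W * d\<^sup>2 * 2" "cmod (of_real vL * hL) \<le> W * d\<^sup>2 * 2"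
    unfolding norm_mult norm_of_real using rates h by (auto intro!: mult_mono)
  then have 3: "cmod (b * (of_real v0 * h0 + of_real y * (of_real vL * hL - of_real v0 * h0)))
      \<le> K * (W * d\<^sup>2 * 2)"
    unfolding norm_mult[of b] using pos by (intro mult_mono[OF b] convex) auto
  have "cmod (of_real q * b * \<eta> y - (c * \<eta> z - 2 * (b * \<eta> y) + a * \<eta> x)
       - b * (of_real v0 * h0 + of_real y * (of_real vL * hL - of_real v0 * h0)))
    \<le> U * d\<^sup>2 * K * 2 + (2 * (V * d\<^sup>2 * K) + 4 * (d\<^sup>2 * (K * (V + 12 / L + 6 / L\<^sup>2)))) + K * (W * d\<^sup>2 * 2)"
    by (rule order_trans[OF norm_triangle_ineq4 add_mono[OF order_trans[OF norm_triangle_ineq4 add_mono[OF 1 2]] 3]])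
  also have "\<dots> = d\<^sup>2 * (K * (6 * V + 48 / L + 24 / L\<^sup>2 + 2 * W + 2 * U))"
    by (simp add: algebra_simps)
  finally show ?thesis .
qed

lemma transparent_bc_homogeneous:
  assumes "transparent_bc s \<omega> dt b i \<Phi> \<Psi>" "l \<ge> 1"
  shows "(\<Psi> l i - \<Phi> i * wave \<omega> dt l) - s 0 * (\<Psi> l b - \<Phi> b * wave \<omega> dt l)
    = (\<Sum>p\<in>{1..<l}. s (l - p) * (\<Psi> p b - \<Phi> b * wave \<omega> dt p))
      - (\<Psi> (l - 1) i - \<Phi> i * wave \<omega> dt (l - 1))"
  using assms unfolding transparent_bc_def Let_def wave_def by (simp add: algebra_simps)

lemma norm_2_L2_set:
  assumes "dx \<ge> 0"
  shows "norm_2 J dx u = sqrt dx * L2_set (\<lambda>j. cmod (u j)) {1..<J}"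
  using assms unfolding norm_2_def L2_set_def
  by (simp add: real_sqrt_mult flip: sum_distrib_right)

lemma norm_2_add:
  assumes "dx \<ge> 0"
  shows "norm_2 J dx (\<lambda>j. u j + v j) \<le> norm_2 J dx u + norm_2 J dx v"
proof -
  have "L2_set (\<lambda>j. cmod (u j + v j)) {1..<J} \<le> L2_set (\<lambda>j. cmod (u j) + cmod (v j)) {1..<J}"
    by (intro L2_set_mono norm_triangle_ineq) auto
  also have "\<dots> \<le> L2_set (\<lambda>j. cmod (u j)) {1..<J} + L2_set (\<lambda>j. cmod (v j)) {1..<J}"
    by (rule L2_set_triangle_ineq)
  finally show ?thesis
    using assms unfolding norm_2_L2_set[OF assms] distrib_left[symmetric]
    by (intro mult_left_mono) auto
qed

lemma norm_2_le:
  assumes "dx \<ge> 0" "real J * dx = L" "K \<ge> 0" "\<And>j. j \<in> {1..<J} \<Longrightarrow> cmod (u j) \<le> K"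
  shows "norm_2 J dx u \<le> K * sqrt L"
proof -
  have "(\<Sum>j\<in>{1..<J}. (cmod (u j))\<^sup>2 * dx) \<le> (\<Sum>j\<in>{1..<J}. K\<^sup>2 * dx)"
    using assms by (intro sum_mono mult_right_mono power_mono) auto
  also have "\<dots> = real (J - 1) * (K\<^sup>2 * dx)" by simp
  also have "\<dots> \<le> real J * (K\<^sup>2 * dx)" using assms by (intro mult_right_mono) auto
  also have "\<dots> = K\<^sup>2 * L" using assms(2) by (simp add: algebra_simps)
  finally have "norm_2 J dx u \<le> sqrt (K\<^sup>2 * L)" unfolding norm_2_def by (rule real_sqrt_le_mono)
  then show ?thesis using assms(3) by (simp add: real_sqrt_mult)
qed

lemma norm_inf_ge: "j \<in> {1..<J} \<Longrightarrow> \<bar>q j\<bar> \<le> norm_inf J q"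
  and norm_inf_nonneg: "0 \<le> norm_inf J q"
  unfolding norm_inf_def by (rule Max_ge; force)+

section \<open>Stability in the discrete norm\<close>

text \<open>
  The deviation \<open>w\<close> of \<open>\<Psi>\<close> from the lift starts from zero and satisfies the scheme and the
  homogeneous transparent boundary conditions up to sources of size \<open>O(dx\<^sup>2)\<close>. The scaled scheme
  has \<open>R = 4 m dx\<^sup>2 / (hbar dt)\<close> in front of the time difference, so this is a source of order one
  in the original equation and gives linear growth in \<open>N * dt\<close>.
\<close>
lemma deviation_bound:
  fixes hbar m L dx dt E0 EL QL K V U :: real and \<Phi> :: "nat \<Rightarrow> complex"
    and \<Psi> :: "nat \<Rightarrow> nat \<Rightarrow> complex" and Qh :: "nat \<Rightarrow> nat \<Rightarrow> real" and J N n :: nat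
  assumes pos: "hbar > 0" "m > 0" "L > 0" "dx > 0" "dt > 0" "K \<ge> 0" "U \<ge> 0"
    and J: "J \<ge> 2" and dx: "real J * dx = L"
    and \<Phi>: "\<And>j. j \<le> J \<Longrightarrow> cmod (\<Phi> j) \<le> K"
    and d\<Phi>: "\<And>j. j < J \<Longrightarrow> cmod (\<Phi> (Suc j) - \<Phi> j) \<le> K * dx"
    and stat: "\<And>j. j \<in> {1..<J} \<Longrightarrow> \<Phi> (j + 1) - 2 * \<Phi> j + \<Phi> (j - 1) = of_real (v j) * \<Phi> j"
    and v: "\<And>j. j \<in> {1..<J} \<Longrightarrow> \<bar>v j\<bar> \<le> V * dx\<^sup>2"
    and cn: "crank_nicolson hbar m Qh J dx dt \<Psi>"
    and init: "\<And>j. j \<le> J \<Longrightarrow> \<Psi> 0 j = \<Phi> j"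
    and left: "transparent_bc (conv_s (conv_R hbar m dx dt) 0)
       (2 / dt * arctan (dt * E0 / (2 * hbar))) dt 0 1 \<Phi> \<Psi>"
    and right: "transparent_bc (conv_s (conv_R hbar m dx dt) (conv_sigma hbar m dx QL))
       (2 / dt * arctan (dt * EL / (2 * hbar))) dt J (J - 1) \<Phi> \<Psi>"
    and U: "\<And>l j. l < N \<Longrightarrow> j \<in> {1..<J} \<Longrightarrow> \<bar>Qh l j\<bar> \<le> U"
    and n: "n \<le> N"
  defines "c \<equiv> 2 * m / hbar\<^sup>2"
  defines "A \<equiv> K * (6 * V + 48 / L + 24 / L\<^sup>2 + 2 * (c * (\<bar>E0\<bar> + \<bar>EL\<bar>)) + 2 * (c * U))"
  shows "norm_2 J dx (\<Psi> n) \<le> real N * dt * (hbar / (2 * m)) * A * sqrt (2 * L) + K * sqrt L"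
proof -
  define R where "R = conv_R hbar m dx dt"
  have R: "R > 0" unfolding R_def conv_R_def using pos by simp
  have c0: "c > 0" unfolding c_def using pos by simp
  define e0 where "e0 = wave (2 / dt * arctan (dt * E0 / (2 * hbar))) dt"
  define eL where "eL = wave (2 / dt * arctan (dt * EL / (2 * hbar))) dt"
  define \<tau> where "\<tau> j = smoothstep (real j / real J)" for j
  define g where "g l j = e0 l + of_real (\<tau> j) * (eL l - e0 l)" for l j
  define w where "w l j = \<Psi> l j - \<Phi> j * g l j" for l j
  define h0 where "h0 l = e0 (Suc l) + e0 l" for l
  define hL where "hL l = eL (Suc l) + eL l" for l
  define q where "q l j = 2 * m * dx\<^sup>2 / hbar\<^sup>2 * Qh l j" for l j
  define \<eta> where "\<eta> l j = h0 l + of_real (\<tau> j) * (hL l - h0 l)" for l j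
  define v0 where "v0 = 2 * m * dx\<^sup>2 / hbar\<^sup>2 * E0"
  define vL where "vL = 2 * m * dx\<^sup>2 / hbar\<^sup>2 * EL"
  \<comment> \<open>At the ends the lift differs from \<open>\<Phi> e\<^sub>0\<close> and \<open>\<Phi> e\<^sub>L\<close> at the adjacent node only.\<close>
  define G where "G l j = (if j = 0 then \<Phi> 1 * of_real (\<tau> 1) * (hL l - h0 l)
     else if j = J then \<Phi> (J - 1) * of_real (1 - \<tau> (J - 1)) * (h0 l - hL l)
     else of_real (q l j) * \<Phi> j * \<eta> l j
       - (\<Phi> (j + 1) * \<eta> l (j + 1) - 2 * (\<Phi> j * \<eta> l j) + \<Phi> (j - 1) * \<eta> l (j - 1))
       - \<Phi> j * (of_real v0 * h0 l + of_real (\<tau> j) * (of_real vL * hL l - of_real v0 * h0 l)))" for l j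
  have \<eta>: "g (Suc l) j + g l j = \<eta> l j" for l j
    by (simp add: g_def \<eta>_def h0_def hL_def algebra_simps)
  have h2: "cmod (h0 l) \<le> 2" "cmod (hL l) \<le> 2" for l
    unfolding h0_def hL_def e0_def eL_def
    by (rule order_trans[OF norm_triangle_ineq], simp)+
  have chi_ends: "\<tau> 0 = 0" "\<tau> J = 1" using J by (simp_all add: \<tau>_def smoothstep_def)
  have chi01: "0 \<le> \<tau> j" "\<tau> j \<le> 1" if "j \<le> J" for j
    unfolding \<tau>_def using that J by (auto intro!: smoothstep_bounds simp: field_simps)
  have dxL: "1 / real J = dx / L" using dx[symmetric] J pos by (simp add: field_simps)
  have chi_diff: "\<bar>\<tau> (Suc j) - \<tau> j\<bar> \<le> 6 * (dx / L)" if "j < J" for j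
  proof -
    have "real (Suc j) / real J = real j / real J + 1 / real J" by (simp add: add_divide_distrib)
    then show ?thesis unfolding \<tau>_def dxL[symmetric]
      using smoothstep_diff[of "real j / real J" "1 / real J"] that J by (simp add: field_simps)
  qed
  have chi_second: "\<bar>\<tau> (j + 1) - 2 * \<tau> j + \<tau> (j - 1)\<bar> \<le> 6 * (dx / L)\<^sup>2" if j: "j \<in> {1..<J}" for j
  proof -
    have "real (j + 1) / real J = real j / real J + 1 / real J"
      "real (j - 1) / real J = real j / real J - 1 / real J"
      using j by (simp_all add: add_divide_distrib diff_divide_distrib of_nat_diff)
    then show ?thesis unfolding \<tau>_def dxL[symmetric]
      using smoothstep_second_diff[of "real j / real J" "1 / real J"] j by simp
  qed
  have chi_1: "\<tau> 1 \<le> 3 * (dx / L)\<^sup>2"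
    unfolding \<tau>_def smoothstep_def dxL[symmetric] by simp
  have chi_J: "1 - \<tau> (J - 1) \<le> 3 * (dx / L)\<^sup>2"
  proof -
    have "real (J - 1) / real J = 1 - 1 / real J" using J by (simp add: of_nat_diff field_simps)
    moreover have "1 - smoothstep (1 - s) = 3 * s\<^sup>2 - 2 * s ^ 3" for s
      by (simp add: smoothstep_def power2_eq_square power3_eq_cube algebra_simps)
    ultimately show ?thesis unfolding \<tau>_def dxL[symmetric] by simp
  qed
  have V: "V \<ge> 0"
  proof -
    have "0 \<le> V * dx\<^sup>2" using v[of 1] J by force
    then show ?thesis using pos by (simp add: zero_le_mult_iff)
  qed
  have A_ge: "K * (24 / L\<^sup>2) \<le> A"
    unfolding A_def using pos V c0 by (intro mult_left_mono) auto
  have G_bound: "cmod (G l j) \<le> dx\<^sup>2 * A" if l: "l < N" and j: "j \<le> J" for l j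
  proof -
    have hd: "cmod (hL l - h0 l) \<le> 4"
      using norm_triangle_ineq4[of "hL l" "h0 l"] h2[of l] by linarith
    have ends: "cmod (\<Phi> i * of_real t * z) \<le> dx\<^sup>2 * A"
      if "i \<le> J" "0 \<le> t" "t \<le> 3 * (dx / L)\<^sup>2" "cmod z \<le> 4" for i t z
    proof -
      have "cmod (\<Phi> i * of_real t * z) \<le> K * (3 * (dx / L)\<^sup>2) * 4"
        unfolding norm_mult norm_of_real using that \<Phi>[OF that(1)] pos
        by (intro mult_mono mult_nonneg_nonneg) auto
      also have "\<dots> = dx\<^sup>2 * (K * (12 / L\<^sup>2))" by (simp add: power_divide)
      also have "\<dots> \<le> dx\<^sup>2 * (K * (24 / L\<^sup>2))"
        using pos by (intro mult_left_mono divide_right_mono) auto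
      also have "\<dots> \<le> dx\<^sup>2 * A" using A_ge by (intro mult_left_mono) auto
      finally show ?thesis .
    qed
    consider "j = 0" | "j = J" "j \<noteq> 0" | "j \<in> {1..<J}" using j by fastforce
    then show ?thesis
    proof cases
      case 1
      then have "G l j = \<Phi> 1 * of_real (\<tau> 1) * (hL l - h0 l)" by (simp add: G_def)
      then show ?thesis using ends[OF _ chi01(1) chi_1 hd] J by simp
    next
      case 2
      then have "G l j = \<Phi> (J - 1) * of_real (1 - \<tau> (J - 1)) * (h0 l - hL l)" by (simp add: G_def)
      moreover have "0 \<le> 1 - \<tau> (J - 1)" using chi01(2)[of "J - 1"] by simp
      moreover have "cmod (h0 l - hL l) \<le> 4" using hd by (simp add: norm_minus_commute)
      ultimately show ?thesis using ends[OF _ _ chi_J] by simp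
    next
      case 3
      have rates: "\<bar>v0\<bar> \<le> c * (\<bar>E0\<bar> + \<bar>EL\<bar>) * dx\<^sup>2" "\<bar>vL\<bar> \<le> c * (\<bar>E0\<bar> + \<bar>EL\<bar>) * dx\<^sup>2"
        "\<bar>q l j\<bar> \<le> c * U * dx\<^sup>2"
      proof -
        have *: "2 * m * dx\<^sup>2 / hbar\<^sup>2 * t = c * t * dx\<^sup>2" for t by (simp add: c_def)
        have "\<bar>c * t * dx\<^sup>2\<bar> \<le> c * b * dx\<^sup>2" if "\<bar>t\<bar> \<le> b" for t b
          using that c0 by (simp add: abs_mult mult_right_mono)
        then show "\<bar>v0\<bar> \<le> c * (\<bar>E0\<bar> + \<bar>EL\<bar>) * dx\<^sup>2" "\<bar>vL\<bar> \<le> c * (\<bar>E0\<bar> + \<bar>EL\<bar>) * dx\<^sup>2"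
          "\<bar>q l j\<bar> \<le> c * U * dx\<^sup>2"
          unfolding v0_def vL_def q_def * using U[OF l 3] by simp_all
      qed
      have jj: "j \<le> J" "j < J" "Suc (j - 1) = j" "j - 1 < J" using 3 by auto
      have "cmod (\<Phi> (j + 1) - \<Phi> j) \<le> K * dx" "cmod (\<Phi> j - \<Phi> (j - 1)) \<le> K * dx"
        "\<bar>\<tau> (j + 1) - \<tau> j\<bar> \<le> 6 * (dx / L)" "\<bar>\<tau> j - \<tau> (j - 1)\<bar> \<le> 6 * (dx / L)"
        using d\<Phi>[OF jj(2)] d\<Phi>[OF jj(4)] chi_diff[OF jj(2)] chi_diff[OF jj(4)] unfolding jj(3) by simp_all
      note lift_residual_bound[OF chi01[OF jj(1)] h2[of l] \<Phi>[OF jj(1)] this(1,2) stat[OF 3] v[OF 3]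
          this(3,4) chi_second[OF 3] rates pos(4,3,6)]
      moreover have "G l j = of_real (q l j) * \<Phi> j * \<eta> l j
       - (\<Phi> (j + 1) * \<eta> l (j + 1) - 2 * (\<Phi> j * \<eta> l j) + \<Phi> (j - 1) * \<eta> l (j - 1))
       - \<Phi> j * (of_real v0 * h0 l + of_real (\<tau> j) * (of_real vL * hL l - of_real v0 * h0 l))"
        using 3 by (simp add: G_def)
      ultimately show ?thesis unfolding A_def \<eta>_def by simp
    qed
  qed
  have w0: "w 0 j = 0" if "j \<le> J" for j
    using init[OF that] by (simp add: w_def g_def e0_def eL_def wave_def)
  have Hw: "w (Suc l) j + w l j = (\<Psi> (Suc l) j + \<Psi> l j) - \<Phi> j * \<eta> l j" for l j
    unfolding \<eta>[symmetric] w_def by (simp add: algebra_simps)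
  have scheme: "(w (Suc l) (j + 1) + w l (j + 1)) - 2 * (w (Suc l) j + w l j) + (w (Suc l) (j - 1) + w l (j - 1))
      = - \<i> * of_real R * (w (Suc l) j - w l j) + of_real (q l j) * (w (Suc l) j + w l j) + G l j"
    if j: "j \<in> {1..<J}" for l j
  proof -
    have E0: "\<i> * of_real R * (e0 (Suc l) - e0 l) = of_real v0 * h0 l"
      unfolding R_def e0_def v0_def h0_def using wave_scaled[OF pos(5,1,2)] .
    have EL: "\<i> * of_real R * (eL (Suc l) - eL l) = of_real vL * hL l"
      unfolding R_def eL_def vL_def hL_def using wave_scaled[OF pos(5,1,2)] .
    have "\<i> * of_real R * (g (Suc l) j - g l j)
        = \<i> * of_real R * (e0 (Suc l) - e0 l) + of_real (\<tau> j) *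
          (\<i> * of_real R * (eL (Suc l) - eL l) - \<i> * of_real R * (e0 (Suc l) - e0 l))"
      by (simp add: g_def algebra_simps)
    then have g: "\<i> * of_real R * (g (Suc l) j - g l j)
        = of_real v0 * h0 l + of_real (\<tau> j) * (of_real vL * hL l - of_real v0 * h0 l)"
      unfolding E0 EL .
    have "(\<Psi> (Suc l) (j + 1) + \<Psi> l (j + 1)) - 2 * (\<Psi> (Suc l) j + \<Psi> l j) + (\<Psi> (Suc l) (j - 1) + \<Psi> l (j - 1))
        = - \<i> * of_real R * (\<Psi> (Suc l) j - \<Psi> l j) + of_real (q l j) * (\<Psi> (Suc l) j + \<Psi> l j)"
      unfolding R_def q_def by (rule crank_nicolson_scaled[OF cn pos(1,2,4,5) j])
    moreover have "G l j = of_real (q l j) * \<Phi> j * \<eta> l j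
       - (\<Phi> (j + 1) * \<eta> l (j + 1) - 2 * (\<Phi> j * \<eta> l j) + \<Phi> (j - 1) * \<eta> l (j - 1))
       - \<Phi> j * (\<i> * of_real R * (g (Suc l) j - g l j))"
      unfolding g using j by (simp add: G_def)
    moreover have "w (Suc l) j - w l j = (\<Psi> (Suc l) j - \<Psi> l j) - \<Phi> j * (g (Suc l) j - g l j)"
      by (simp add: w_def algebra_simps)
    ultimately show ?thesis unfolding Hw by (simp only:) (simp add: algebra_simps)
  qed
  have dissipation_left: "(\<Sum>l<n. Im (cnj (w (Suc l) 0 + w l 0) * (w (Suc l) 1 + w l 1 + G l 0)))
      \<le> - R * (cmod (w n 0))\<^sup>2" for n
  proof -
    define u where "u l = \<Psi> l 0 - \<Phi> 0 * e0 l" for l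
    define u' where "u' l = \<Psi> l 1 - \<Phi> 1 * e0 l" for l
    have u: "w l 0 = u l" for l by (simp add: u_def w_def g_def chi_ends)
    have u': "w (Suc l) 1 + w l 1 + G l 0 = u' (Suc l) + u' l" for l
      by (simp add: u'_def w_def g_def G_def h0_def hL_def algebra_simps)
    have "u 0 = 0" "u' 0 = 0" using init J by (simp_all add: u_def u'_def e0_def wave_def)
    then have "(\<Sum>l<n. Im (cnj (u (Suc l) + u l) * (u' (Suc l) + u' l))) \<le> - R * (cmod (u n))\<^sup>2"
      unfolding R_def u_def u'_def e0_def
      by (intro transparent_dissipation[where \<sigma> = 0] transparent_bc_homogeneous[OF left])
        (use R R_def in simp_all)
    then show ?thesis unfolding u u' .
  qed
  have dissipation_right: "(\<Sum>l<n. Im (cnj (w (Suc l) J + w l J) * (w (Suc l) (J - 1) + w l (J - 1) + G l J)))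
      \<le> - R * (cmod (w n J))\<^sup>2" for n
  proof -
    define u where "u l = \<Psi> l J - \<Phi> J * eL l" for l
    define u' where "u' l = \<Psi> l (J - 1) - \<Phi> (J - 1) * eL l" for l
    have u: "w l J = u l" for l by (simp add: u_def w_def g_def chi_ends)
    have u': "w (Suc l) (J - 1) + w l (J - 1) + G l J = u' (Suc l) + u' l" for l
      using J by (simp add: u'_def w_def g_def G_def h0_def hL_def algebra_simps)
    have "u 0 = 0" "u' 0 = 0" using init J by (simp_all add: u_def u'_def eL_def wave_def)
    then have "(\<Sum>l<n. Im (cnj (u (Suc l) + u l) * (u' (Suc l) + u' l))) \<le> - R * (cmod (u n))\<^sup>2"
      unfolding R_def u_def u'_def eL_def
      by (intro transparent_dissipation[where \<sigma> = "conv_sigma hbar m dx QL"]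
          transparent_bc_homogeneous[OF right]) (use R R_def in simp_all)
    then show ?thesis unfolding u u' .
  qed
  have J1: "J \<ge> 1" using J by simp
  have "R * L2_set (\<lambda>j. cmod (w n j)) {..J} \<le> 2 * real N * (dx\<^sup>2 * A) * sqrt (real J + 1)"
    by (rule discrete_energy_estimate[OF R J1 w0 scheme dissipation_left dissipation_right G_bound n])
  then have "L2_set (\<lambda>j. cmod (w n j)) {..J} \<le> 2 * real N * (dx\<^sup>2 * A) * sqrt (real J + 1) / R"
    using R by (simp add: pos_le_divide_eq mult.commute)
  also have "\<dots> = real N * dt * (hbar / (2 * m)) * A * sqrt (real J + 1)"
    unfolding R_def conv_R_def using pos by (simp add: field_simps)
  finally have L2w: "L2_set (\<lambda>j. cmod (w n j)) {..J} \<le> \<dots>" .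
  have A: "A \<ge> 0" using order_trans[OF _ A_ge] pos by simp
  have "norm_2 J dx (w n) \<le> sqrt dx * L2_set (\<lambda>j. cmod (w n j)) {..J}"
    unfolding norm_2_L2_set[OF less_imp_le[OF pos(4)]] L2_set_def
    using pos by (intro mult_left_mono real_sqrt_le_mono sum_mono2) auto
  also have "\<dots> \<le> sqrt dx * (real N * dt * (hbar / (2 * m)) * A * sqrt (real J + 1))"
    using L2w pos by (intro mult_left_mono) auto
  also have "\<dots> = real N * dt * (hbar / (2 * m)) * A * sqrt (dx * (real J + 1))"
    by (simp add: real_sqrt_mult)
  also have "\<dots> \<le> real N * dt * (hbar / (2 * m)) * A * sqrt (2 * L)"
  proof (intro mult_left_mono real_sqrt_le_mono)
    have "dx * 1 \<le> dx * real J" using J pos by (intro mult_left_mono) auto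
    then show "dx * (real J + 1) \<le> 2 * L" using dx by (simp add: algebra_simps)
    show "0 \<le> real N * dt * (hbar / (2 * m)) * A"
      using A pos by (intro mult_nonneg_nonneg) auto
  qed
  finally have w_bound: "norm_2 J dx (w n) \<le> \<dots>" .
  have "norm_2 J dx (\<lambda>j. \<Phi> j * g n j) \<le> K * sqrt L"
  proof (rule norm_2_le[OF less_imp_le[OF pos(4)] dx pos(6)])
    fix j assume "j \<in> {1..<J}"
    then have j: "j \<le> J" by simp
    have "g n j = of_real (1 - \<tau> j) * e0 n + of_real (\<tau> j) * eL n" by (simp add: g_def algebra_simps)
    then have "cmod (g n j) \<le> cmod (of_real (1 - \<tau> j) * e0 n) + cmod (of_real (\<tau> j) * eL n)"
      by (simp only: norm_triangle_ineq)
    also have "\<dots> = 1"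
      unfolding norm_mult norm_of_real using chi01[OF j] by (simp add: e0_def eL_def)
    finally have "cmod (\<Phi> j) * cmod (g n j) \<le> K * 1"
      using \<Phi>[OF j] pos by (intro mult_mono) auto
    then show "cmod (\<Phi> j * g n j) \<le> K" by (simp add: norm_mult)
  qed
  moreover have "\<Psi> n = (\<lambda>j. w n j + \<Phi> j * g n j)" by (simp add: w_def)
  ultimately show ?thesis
    using norm_2_add[OF less_imp_le[OF pos(4)], of J "w n" "\<lambda>j. \<Phi> j * g n j"] w_bound by simp
qed

theorem theoremC2:
  fixes hbar m L k QIL QL M :: real
  assumes "hbar > 0" and "m > 0" and "L > 0" and "k \<noteq> 0"
  shows "\<exists>C>0. \<forall>(QI :: real \<Rightarrow> real) (Q :: real \<Rightarrow> real \<Rightarrow> real) (J :: nat) (dx :: real) (dt :: real)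
            (Qh :: nat \<Rightarrow> nat \<Rightarrow> real) (\<Phi> :: nat \<Rightarrow> complex) (\<Psi> :: nat \<Rightarrow> nat \<Rightarrow> complex).
      initial_potential L QIL QI \<longrightarrow>
      (SUP x\<in>{0<..<L}. \<bar>QI x\<bar>) = M \<longrightarrow>
      time_potential L QL QI Q \<longrightarrow>
      J \<ge> 1 \<longrightarrow> dx = L / real J \<longrightarrow> dt > 0 \<longrightarrow>
      dx < 1 / sqrt (k\<^sup>2 + 2 * m / hbar\<^sup>2 * \<bar>QIL\<bar>) \<longrightarrow>
      stationary_solution hbar m QIL k QI J dx \<Phi> \<longrightarrow>
      time_dependent_solution hbar m QIL QL k Qh J dx dt \<Phi> \<Psi> \<longrightarrow>
      (\<forall>N :: nat. \<forall>l\<le>N.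
        norm_2 J dx (\<Psi> l)
          \<le> C * ((1 + Max ((\<lambda>n. norm_inf J (Qh n)) ` {0..N})) * (real N * dt) + 1))"
proof -
  define E0 where "E0 = energy hbar m QIL k"
  define EL where "EL = E0 + QL - QIL"
  define c where "c = 2 * m / hbar\<^sup>2"
  define V where "V = c * (\<bar>M\<bar> + \<bar>E0\<bar>)"
  define K where "K = exp ((1 + V) * L) * (2 + 2 * \<bar>k\<bar>)"
  define B where "B = 6 * V + 48 / L + 24 / L\<^sup>2 + 2 * (c * (\<bar>E0\<bar> + \<bar>EL\<bar>))"
  define D where "D = (hbar / (2 * m)) * K * (B + 2 * c) * sqrt (2 * L)"
  define C where "C = D + K * sqrt L"
  have c: "c > 0" unfolding c_def using assms by simp
  have V: "V \<ge> 0" unfolding V_def using c by simp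
  have K: "K > 0" unfolding K_def by (intro mult_pos_pos) auto
  have B: "B \<ge> 0" unfolding B_def using V c assms by (intro add_nonneg_nonneg) auto
  have D: "D \<ge> 0" unfolding D_def using B c K assms by (intro mult_nonneg_nonneg) auto
  have KL: "K * sqrt L > 0" using K assms by simp
  have C: "C > 0" unfolding C_def using D KL by linarith
  show ?thesis
  proof (intro exI[of _ C] conjI C allI impI)
    fix QI :: "real \<Rightarrow> real" and Q :: "real \<Rightarrow> real \<Rightarrow> real" and J :: nat and dx dt :: real
      and Qh :: "nat \<Rightarrow> nat \<Rightarrow> real" and \<Phi> :: "nat \<Rightarrow> complex" and \<Psi> :: "nat \<Rightarrow> nat \<Rightarrow> complex"
      and N n :: nat
    assume QI: "initial_potential L QIL QI" and M: "(SUP x\<in>{0<..<L}. \<bar>QI x\<bar>) = M"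
      and J: "J \<ge> 1" and dx: "dx = L / real J" and dt: "dt > 0"
      and small: "dx < 1 / sqrt (k\<^sup>2 + 2 * m / hbar\<^sup>2 * \<bar>QIL\<bar>)"
      and stat: "stationary_solution hbar m QIL k QI J dx \<Phi>"
      and sol: "time_dependent_solution hbar m QIL QL k Qh J dx dt \<Phi> \<Psi>"
      and n: "n \<le> N"
    define U where "U = Max ((\<lambda>n. norm_inf J (Qh n)) ` {0..N})"
    have U_ge: "norm_inf J (Qh l) \<le> U" if "l \<le> N" for l
      unfolding U_def using that by (intro Max_ge) auto
    have U: "U \<ge> 0" using U_ge[of 0] norm_inf_nonneg[of J "Qh 0"] by linarith
    have dx_pos: "dx > 0" and JdxL: "real J * dx = L" using dx J assms by simp_all
    have dxk: "dx * \<bar>k\<bar> < 1"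
    proof -
      have "\<bar>k\<bar> = sqrt (k\<^sup>2)" by simp
      also have "\<dots> \<le> sqrt (k\<^sup>2 + 2 * m / hbar\<^sup>2 * \<bar>QIL\<bar>)"
        using assms(1,2) by (intro real_sqrt_le_mono) simp
      finally have k_le: "\<bar>k\<bar> \<le> \<dots>" .
      then have "dx * \<bar>k\<bar> \<le> dx * sqrt (k\<^sup>2 + 2 * m / hbar\<^sup>2 * \<bar>QIL\<bar>)"
        using dx_pos by (intro mult_left_mono) auto
      also have "\<dots> < 1"
      proof -
        have "sqrt (k\<^sup>2 + 2 * m / hbar\<^sup>2 * \<bar>QIL\<bar>) > 0" using k_le assms(4) by linarith
        then show ?thesis using small by (simp only: pos_less_divide_eq)
      qed
      finally show ?thesis .
    qed
    have M_ge: "\<bar>QI x\<bar> \<le> \<bar>M\<bar>" if "x \<in> {0<..<L}" for x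
    proof -
      obtain b where "\<And>x. \<bar>QI x\<bar> \<le> b"
        using QI unfolding initial_potential_def bounded_iff by auto
      then have "bdd_above ((\<lambda>x. \<bar>QI x\<bar>) ` {0<..<L})" by (intro bdd_aboveI2)
      then have "\<bar>QI x\<bar> \<le> M" using that unfolding M[symmetric] by (intro cSUP_upper)
      then show ?thesis by simp
    qed
    have QI_le: "\<bar>QI (real j * dx)\<bar> \<le> \<bar>M\<bar>" if "j \<in> {1..<J}" for j
    proof (rule M_ge)
      have "real j * dx < real J * dx" using that dx_pos by (intro mult_strict_right_mono) auto
      then show "real j * dx \<in> {0<..<L}" using that dx_pos JdxL by simp
    qed
    note \<Phi> = stationary_bounds[OF assms(1,2,4) J dx_pos JdxL dxk QI_le stat,
        folded E0_def, folded c_def, folded V_def, folded K_def]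
    show "norm_2 J dx (\<Psi> n) \<le> C * ((1 + U) * (real N * dt) + 1)"
    proof (cases "J = 1")
      case True
      then show ?thesis using C U dt by (simp add: norm_2_def)
    next
      case False
      then have J2: "J \<ge> 2" using J by simp
      define v where "v j = dx\<^sup>2 * (c * (QI (real j * dx) - E0))" for j
      have rec: "\<Phi> (j + 1) - 2 * \<Phi> j + \<Phi> (j - 1) = of_real (v j) * \<Phi> j"
        and v: "\<bar>v j\<bar> \<le> V * dx\<^sup>2" if "j \<in> {1..<J}" for j
        unfolding v_def V_def E0_def c_def
        using stationary_recurrence[OF stat dx_pos that]
          stationary_coefficient_bound[OF less_imp_le[OF c] QI_le[OF that], unfolded c_def] by blast+
      have "norm_2 J dx (\<Psi> n) \<le> real N * dt * (hbar / (2 * m)) * (K * (6 * V + 48 / L + 24 / L\<^sup>2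
           + 2 * (2 * m / hbar\<^sup>2 * (\<bar>E0\<bar> + \<bar>EL\<bar>)) + 2 * (2 * m / hbar\<^sup>2 * U))) * sqrt (2 * L) + K * sqrt L"
      proof (rule deviation_bound[OF assms(1-3) dx_pos dt less_imp_le[OF K] U J2 JdxL \<Phi> rec v _ _ _ _ _ n])
        show "crank_nicolson hbar m Qh J dx dt \<Psi>" "\<And>j. j \<le> J \<Longrightarrow> \<Psi> 0 j = \<Phi> j"
          "transparent_bc (conv_s (conv_R hbar m dx dt) 0) (2 / dt * arctan (dt * E0 / (2 * hbar))) dt 0 1 \<Phi> \<Psi>"
          using sol unfolding time_dependent_solution_def omega_0_def E0_def by auto
        have "omega_L hbar m QIL QL k dt = 2 / dt * arctan (dt * EL / (2 * hbar))"
          by (simp add: omega_L_def EL_def E0_def)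
        then show "transparent_bc (conv_s (conv_R hbar m dx dt) (conv_sigma hbar m dx QL))
            (2 / dt * arctan (dt * EL / (2 * hbar))) dt J (J - 1) \<Phi> \<Psi>"
          using sol unfolding time_dependent_solution_def by simp
        show "\<bar>Qh l j\<bar> \<le> U" if "l < N" "j \<in> {1..<J}" for l j
          using norm_inf_ge[OF that(2), of "Qh l"] U_ge[of l] that(1) by simp
      qed
      also have "\<dots> = real N * dt * ((hbar / (2 * m)) * K * (B + 2 * c * U) * sqrt (2 * L)) + K * sqrt L"
        unfolding B_def c_def[symmetric] by (simp add: mult_ac)
      also have "\<dots> \<le> real N * dt * (D * (1 + U)) + K * sqrt L"
      proof -
        have "B + 2 * c * U \<le> (B + 2 * c) * (1 + U)"
          using B c U by (simp add: algebra_simps)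
        then have "(hbar / (2 * m)) * K * (B + 2 * c * U) * sqrt (2 * L)
            \<le> (hbar / (2 * m)) * K * ((B + 2 * c) * (1 + U)) * sqrt (2 * L)"
          using assms K by (intro mult_left_mono mult_right_mono) auto
        also have "\<dots> = D * (1 + U)" unfolding D_def by (simp add: mult_ac)
        finally show ?thesis using dt by (intro add_right_mono mult_left_mono) auto
      qed
      also have "\<dots> \<le> C * ((1 + U) * (real N * dt)) + C * 1"
      proof (rule add_mono)
        have "D \<le> C" "K * sqrt L \<le> C" unfolding C_def using D KL by linarith+
        then show "K * sqrt L \<le> C * 1" by simp
        have "D * ((1 + U) * (real N * dt)) \<le> C * ((1 + U) * (real N * dt))"
          using \<open>D \<le> C\<close> U dt by (intro mult_right_mono) auto
        then show "real N * dt * (D * (1 + U)) \<le> C * ((1 + U) * (real N * dt))"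
          by (simp only: mult_ac)
      qed
      finally show ?thesis by (simp only: distrib_left)
    qed
  qed
qed

end
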